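(* Let $H$ be a Hopf algebra over a field $k$. Then the maps $K\mapsto H/HK^+$ and $Q\mapsto{}^{co\,Q}H$ give a bijective correspondence (are mutually inverse bijections) $$\{K\subseteq H: K\text{ a right coideal subalgebra}\}\ \simeq\ \{H/I: I\text{ a left ideal coideal}\}$$ if and only if both of the following hold: (1) for every generalised quotient $Q=H/I$ of $H$ ($I$ a left ideal coideal) the extension ${}^{co\,Q}H\subseteq H$ is $Q$-Galois; (2) ${}^{co\,H/HK^+}H\subseteq K$ for every right coideal subalgebra $K$ of $H$.
   Context: Write $\Delta(h)=h_{(1)}\otimes h_{(2)}$. A right coideal subalgebra is a subalgebra $K$ with $\Delta(K)\subseteq K\otimes H$; $K^+=K\cap\ker\epsilon$. A left ideal coideal is a coideal of $H$ which is also a left ideal. For $Q=H/I$ with quotient map $\pi$, ${}^{co\,Q}H=\{h\in H:\pi(h_{(1)})\otimes h_{(2)}=\pi(1)\otimes h\}$, which is a right coideal subalgebra; for a right coideal subalgebra $K$, $HK^+$ is a left ideal coideal. The extension ${}^{co\,Q}H\subseteq H$ is $Q$-Galois if $H\otimes_{{}^{co\,Q}H}H\to Q\otimes H$, $x\otimes y\mapsto\pi(x_{(1)})\otimes x_{(2)}y$, is bijective. *)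

theory Defs
  imports Complex_Main "HOL-Library.Poly_Mapping" "HOL-Library.Set_Algebras"
begin

section \<open>Vector spaces with a carrier, and their quotients\<close>

text \<open>
  Algebras live on a whole type, but quotients and tensor products consist of cosets and need a
  carrier. The addition is always that of the type: on cosets it is the addition of sets from
  Set-Algebras, for which the zero of a quotient space \<open>V/W\<close> is \<open>W\<close> and not the
  type's zero \<open>{0}\<close>.
\<close>

record ('k, 'v) vspace =
  vcarrier :: "'v set"
  vzero :: "'v"
  vscale :: "'k \<Rightarrow> 'v \<Rightarrow> 'v"

definition whole_space :: "('k \<Rightarrow> 'v \<Rightarrow> 'v) \<Rightarrow> ('k, 'v::ab_group_add) vspace" where
  "whole_space scale = \<lparr>vcarrier = UNIV, vzero = 0, vscale = scale\<rparr>"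

text \<open>In the scalar multiplication, adding \<open>W\<close> matters only for the scalar \<open>0\<close>.\<close>

definition quotient_space ::
    "'v set \<Rightarrow> ('k \<Rightarrow> 'v \<Rightarrow> 'v) \<Rightarrow> 'v set \<Rightarrow> ('k, 'v::ab_group_add set) vspace" where
  "quotient_space V scale W =
     \<lparr>vcarrier = (\<lambda>v. v +o W) ` V, vzero = W, vscale = (\<lambda>c X. scale c ` X + W)\<rparr>"

section \<open>Tensor products\<close>

text \<open>
  \<open>'a \<times> 'b \<Rightarrow>\<^sub>0 'k\<close> is the free vector space on pairs. The tensor product is its
  subspace of formal sums with keys in the product of the carriers, modulo the usual relations.
\<close>

definition formal_scale :: "'k::field \<Rightarrow> ('x \<Rightarrow>\<^sub>0 'k) \<Rightarrow> ('x \<Rightarrow>\<^sub>0 'k)" where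
  "formal_scale c = Poly_Mapping.map ((*) c)"

type_synonym ('k, 'a, 'b) tensor_space = "('k, ('a \<times> 'b \<Rightarrow>\<^sub>0 'k) set) vspace"

definition bilinear_relations ::
    "('k::field, 'a::comm_monoid_add) vspace \<Rightarrow> ('k, 'b::comm_monoid_add) vspace
       \<Rightarrow> ('a \<times> 'b \<Rightarrow>\<^sub>0 'k) set" where
  "bilinear_relations M N =
     {Poly_Mapping.single (x + x', y) 1 - Poly_Mapping.single (x, y) 1 - Poly_Mapping.single (x', y) 1
        | x x' y. x \<in> vcarrier M \<and> x' \<in> vcarrier M \<and> y \<in> vcarrier N} \<union>
     {Poly_Mapping.single (x, y + y') 1 - Poly_Mapping.single (x, y) 1 - Poly_Mapping.single (x, y') 1
        | x y y'. x \<in> vcarrier M \<and> y \<in> vcarrier N \<and> y' \<in> vcarrier N} \<union>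
     {Poly_Mapping.single (vscale M c x, y) 1 - formal_scale c (Poly_Mapping.single (x, y) 1)
        | c x y. x \<in> vcarrier M \<and> y \<in> vcarrier N} \<union>
     {Poly_Mapping.single (x, vscale N c y) 1 - formal_scale c (Poly_Mapping.single (x, y) 1)
        | c x y. x \<in> vcarrier M \<and> y \<in> vcarrier N}"

definition formal_sums_mod ::
    "('k::field, 'a) vspace \<Rightarrow> ('k, 'b) vspace \<Rightarrow> ('a \<times> 'b \<Rightarrow>\<^sub>0 'k) set
       \<Rightarrow> ('k, 'a, 'b) tensor_space" where
  "formal_sums_mod M N R =
     quotient_space {p. Poly_Mapping.keys p \<subseteq> vcarrier M \<times> vcarrier N} formal_scale
       (module.span formal_scale R)"

definition tensor ::
    "('k::field, 'a::comm_monoid_add) vspace \<Rightarrow> ('k, 'b::comm_monoid_add) vspace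
       \<Rightarrow> ('k, 'a, 'b) tensor_space" where
  "tensor M N = formal_sums_mod M N (bilinear_relations M N)"

text \<open>
  \<open>H \<otimes>\<^bsub>K\<^esub> H\<close> for a subalgebra \<open>K\<close> of \<open>H\<close>. As \<open>K\<close> contains the scalars, imposing
  \<open>k\<close>-bilinearity as well changes nothing.
\<close>

definition tensor_over ::
    "('k::field \<Rightarrow> 'h \<Rightarrow> 'h) \<Rightarrow> 'h set \<Rightarrow> ('k, 'h::ring_1, 'h) tensor_space" where
  "tensor_over scale K = formal_sums_mod (whole_space scale) (whole_space scale)
     (bilinear_relations (whole_space scale) (whole_space scale) \<union>
      {Poly_Mapping.single (x * a, y) 1 - Poly_Mapping.single (x, a * y) 1 | x a y. a \<in> K})"

definition pure_tensor :: "('k::field, 'a, 'b) tensor_space \<Rightarrow> 'a \<Rightarrow> 'b \<Rightarrow> ('a \<times> 'b \<Rightarrow>\<^sub>0 'k) set" where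
  "pure_tensor T x y = Poly_Mapping.single (x, y) 1 +o vzero T"

text \<open>The image of \<open>A \<otimes> B\<close> in the tensor product \<open>T\<close>.\<close>

definition tensor_image ::
    "('k::field, 'a, 'b) tensor_space \<Rightarrow> 'a set \<Rightarrow> 'b set \<Rightarrow> ('a \<times> 'b \<Rightarrow>\<^sub>0 'k) set set" where
  "tensor_image T A B = {p +o vzero T | p. Poly_Mapping.keys p \<subseteq> A \<times> B}"

text \<open>
  The linear map into \<open>U\<close> that sends \<open>x \<otimes> y\<close> to \<open>b x y\<close>, evaluated on a representative.
  If \<open>b\<close> respects the relations of the tensor product, the choice is immaterial.
  The summand \<open>vzero U\<close> makes an empty sum the zero of \<open>U\<close>.
\<close>

definition tensor_lift ::
    "('k::field, 'v::comm_monoid_add) vspace \<Rightarrow> ('a \<Rightarrow> 'b \<Rightarrow> 'v)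
       \<Rightarrow> ('a \<times> 'b \<Rightarrow>\<^sub>0 'k) set \<Rightarrow> 'v" where
  "tensor_lift U b X =
     (let p = SOME p. p \<in> X in
      vzero U + (\<Sum>(x, y)\<in>Poly_Mapping.keys p. vscale U (Poly_Mapping.lookup p (x, y)) (b x y)))"

section \<open>Hopf algebras\<close>

abbreviation tensor_square :: "('k::field \<Rightarrow> 'h \<Rightarrow> 'h) \<Rightarrow> ('k, 'h::ab_group_add, 'h) tensor_space" where
  "tensor_square scale \<equiv> tensor (whole_space scale) (whole_space scale)"

text \<open>\<open>(x \<otimes> y) \<otimes> z \<mapsto> x \<otimes> (y \<otimes> z)\<close>\<close>

definition tensor_assoc ::
    "('k::field \<Rightarrow> 'h \<Rightarrow> 'h) \<Rightarrow> (('h \<times> 'h \<Rightarrow>\<^sub>0 'k) set \<times> 'h \<Rightarrow>\<^sub>0 'k) set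
       \<Rightarrow> ('h \<times> ('h::ab_group_add \<times> 'h \<Rightarrow>\<^sub>0 'k) set \<Rightarrow>\<^sub>0 'k) set" where
  "tensor_assoc scale =
     (let HH = tensor_square scale; T = tensor (whole_space scale) HH
      in tensor_lift T (\<lambda>t z. tensor_lift T (\<lambda>x y. pure_tensor T x (pure_tensor HH y z)) t))"

definition tensor_mult ::
    "('k::field \<Rightarrow> 'h \<Rightarrow> 'h) \<Rightarrow> ('h \<times> 'h \<Rightarrow>\<^sub>0 'k) set \<Rightarrow> ('h \<times> 'h \<Rightarrow>\<^sub>0 'k) set
       \<Rightarrow> ('h::ring_1 \<times> 'h \<Rightarrow>\<^sub>0 'k) set" where
  "tensor_mult scale X Y =
     (let HH = tensor_square scale
      in tensor_lift HH (\<lambda>a b. tensor_lift HH (\<lambda>c d. pure_tensor HH (a * c) (b * d)) Y) X)"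

locale algebra_over = vector_space scale
  for scale :: "'k::field \<Rightarrow> 'h::ring_1 \<Rightarrow> 'h" +
  assumes scale_mult_left: "scale c (x * y) = scale c x * y"
    and scale_mult_right: "scale c (x * y) = x * scale c y"

locale coalgebra_over = vector_space scale
  for scale :: "'k::field \<Rightarrow> 'h::ab_group_add \<Rightarrow> 'h" +
  fixes \<Delta> :: "'h \<Rightarrow> ('h \<times> 'h \<Rightarrow>\<^sub>0 'k) set"
    and \<epsilon> :: "'h \<Rightarrow> 'k"
  assumes comult_carrier: "\<Delta> x \<in> vcarrier (tensor_square scale)"
    and comult_add: "\<Delta> (x + y) = \<Delta> x + \<Delta> y"
    and comult_scale: "\<Delta> (scale c x) = vscale (tensor_square scale) c (\<Delta> x)"
    and counit_linear: "Vector_Spaces.linear scale (*) \<epsilon>"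
    and coassoc:
      "tensor_assoc scale
         (tensor_lift (tensor (tensor_square scale) (whole_space scale))
           (\<lambda>x y. pure_tensor (tensor (tensor_square scale) (whole_space scale)) (\<Delta> x) y) (\<Delta> h)) =
       tensor_lift (tensor (whole_space scale) (tensor_square scale))
         (\<lambda>x y. pure_tensor (tensor (whole_space scale) (tensor_square scale)) x (\<Delta> y)) (\<Delta> h)"
    and counit_left: "tensor_lift (whole_space scale) (\<lambda>x y. scale (\<epsilon> x) y) (\<Delta> h) = h"
    and counit_right: "tensor_lift (whole_space scale) (\<lambda>x y. scale (\<epsilon> y) x) (\<Delta> h) = h"

locale bialgebra_over = algebra_over scale + coalgebra_over scale \<Delta> \<epsilon>
  for scale :: "'k::field \<Rightarrow> 'h::ring_1 \<Rightarrow> 'h"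
    and \<Delta> :: "'h \<Rightarrow> ('h \<times> 'h \<Rightarrow>\<^sub>0 'k) set"
    and \<epsilon> :: "'h \<Rightarrow> 'k" +
  assumes comult_mult: "\<Delta> (x * y) = tensor_mult scale (\<Delta> x) (\<Delta> y)"
    and comult_one: "\<Delta> 1 = pure_tensor (tensor_square scale) 1 1"
    and counit_mult: "\<epsilon> (x * y) = \<epsilon> x * \<epsilon> y"
    and counit_one: "\<epsilon> 1 = 1"

locale hopf_algebra = bialgebra_over scale \<Delta> \<epsilon>
  for scale :: "'k::field \<Rightarrow> 'h::ring_1 \<Rightarrow> 'h"
    and \<Delta> :: "'h \<Rightarrow> ('h \<times> 'h \<Rightarrow>\<^sub>0 'k) set"
    and \<epsilon> :: "'h \<Rightarrow> 'k" +
  fixes S :: "'h \<Rightarrow> 'h"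
  assumes antipode_linear: "Vector_Spaces.linear scale scale S"
    and antipode_left: "tensor_lift (whole_space scale) (\<lambda>x y. S x * y) (\<Delta> h) = scale (\<epsilon> h) 1"
    and antipode_right: "tensor_lift (whole_space scale) (\<lambda>x y. x * S y) (\<Delta> h) = scale (\<epsilon> h) 1"

section \<open>Right coideal subalgebras and generalised quotients\<close>

definition subalgebra :: "('k::field \<Rightarrow> 'h \<Rightarrow> 'h) \<Rightarrow> 'h::ring_1 set \<Rightarrow> bool" where
  "subalgebra scale K \<longleftrightarrow>
     module.subspace scale K \<and> 1 \<in> K \<and> (\<forall>x\<in>K. \<forall>y\<in>K. x * y \<in> K)"

definition right_coideal_subalgebra ::
    "('k::field \<Rightarrow> 'h \<Rightarrow> 'h) \<Rightarrow> ('h \<Rightarrow> ('h \<times> 'h \<Rightarrow>\<^sub>0 'k) set) \<Rightarrow> 'h::ring_1 set \<Rightarrow> bool" where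
  "right_coideal_subalgebra scale \<Delta> K \<longleftrightarrow>
     subalgebra scale K \<and> \<Delta> ` K \<subseteq> tensor_image (tensor_square scale) K UNIV"

text \<open>\<open>I \<otimes> H + H \<otimes> I\<close> is a sum of sets of elements of \<open>H \<otimes> H\<close>.\<close>

definition coideal ::
    "('k::field \<Rightarrow> 'h \<Rightarrow> 'h) \<Rightarrow> ('h \<Rightarrow> ('h \<times> 'h \<Rightarrow>\<^sub>0 'k) set) \<Rightarrow> ('h \<Rightarrow> 'k)
       \<Rightarrow> 'h::ab_group_add set \<Rightarrow> bool" where
  "coideal scale \<Delta> \<epsilon> I \<longleftrightarrow>
     module.subspace scale I \<and>
     \<Delta> ` I \<subseteq> tensor_image (tensor_square scale) I UNIV + tensor_image (tensor_square scale) UNIV I \<and>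
     (\<forall>x\<in>I. \<epsilon> x = 0)"

definition left_ideal_coideal ::
    "('k::field \<Rightarrow> 'h \<Rightarrow> 'h) \<Rightarrow> ('h \<Rightarrow> ('h \<times> 'h \<Rightarrow>\<^sub>0 'k) set) \<Rightarrow> ('h \<Rightarrow> 'k)
       \<Rightarrow> 'h::ring_1 set \<Rightarrow> bool" where
  "left_ideal_coideal scale \<Delta> \<epsilon> I \<longleftrightarrow> coideal scale \<Delta> \<epsilon> I \<and> (\<forall>h. \<forall>x\<in>I. h * x \<in> I)"

definition right_coideal_subalgebras ::
    "('k::field \<Rightarrow> 'h \<Rightarrow> 'h) \<Rightarrow> ('h \<Rightarrow> ('h \<times> 'h \<Rightarrow>\<^sub>0 'k) set) \<Rightarrow> 'h::ring_1 set set" where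
  "right_coideal_subalgebras scale \<Delta> = {K. right_coideal_subalgebra scale \<Delta> K}"

definition generalised_quotients ::
    "('k::field \<Rightarrow> 'h \<Rightarrow> 'h) \<Rightarrow> ('h \<Rightarrow> ('h \<times> 'h \<Rightarrow>\<^sub>0 'k) set) \<Rightarrow> ('h \<Rightarrow> 'k)
       \<Rightarrow> ('k, 'h::ring_1 set) vspace set" where
  "generalised_quotients scale \<Delta> \<epsilon> =
     {quotient_space UNIV scale I | I. left_ideal_coideal scale \<Delta> \<epsilon> I}"

text \<open>\<open>H/HK\<^sup>+\<close>, where \<open>HK\<^sup>+\<close> consists of the finite sums of products.\<close>

definition quotient_by ::
    "('k::field \<Rightarrow> 'h \<Rightarrow> 'h) \<Rightarrow> ('h \<Rightarrow> 'k) \<Rightarrow> 'h::ring_1 set \<Rightarrow> ('k, 'h set) vspace" where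
  "quotient_by scale \<epsilon> K =
     quotient_space UNIV scale (module.span scale {h * x | h x. x \<in> K \<and> \<epsilon> x = 0})"

text \<open>For \<open>Q = H/I\<close> the zero of \<open>Q\<close> is \<open>I\<close>, so that \<open>x +o vzero Q\<close> is the class of \<open>x\<close>.\<close>

definition quotient_map :: "('k, 'h::ab_group_add set) vspace \<Rightarrow> 'h \<Rightarrow> 'h set" where
  "quotient_map Q x = x +o vzero Q"

definition coinvariants ::
    "('k::field \<Rightarrow> 'h \<Rightarrow> 'h) \<Rightarrow> ('h \<Rightarrow> ('h \<times> 'h \<Rightarrow>\<^sub>0 'k) set) \<Rightarrow> ('k, 'h set) vspace
       \<Rightarrow> 'h::ring_1 set" where
  "coinvariants scale \<Delta> Q =
     (let QH = tensor Q (whole_space scale) in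
      {h. tensor_lift QH (\<lambda>x y. pure_tensor QH (quotient_map Q x) y) (\<Delta> h)
          = pure_tensor QH (quotient_map Q 1) h})"

text \<open>\<open>x \<otimes> y \<mapsto> \<pi>(x\<^sub>1) \<otimes> x\<^sub>2 y\<close>\<close>

definition canonical_map ::
    "('k::field \<Rightarrow> 'h \<Rightarrow> 'h) \<Rightarrow> ('h \<Rightarrow> ('h \<times> 'h \<Rightarrow>\<^sub>0 'k) set) \<Rightarrow> ('k, 'h set) vspace
       \<Rightarrow> ('h::ring_1 \<times> 'h \<Rightarrow>\<^sub>0 'k) set \<Rightarrow> ('h set \<times> 'h \<Rightarrow>\<^sub>0 'k) set" where
  "canonical_map scale \<Delta> Q =
     (let QH = tensor Q (whole_space scale) in
      tensor_lift QH
        (\<lambda>x y. tensor_lift QH (\<lambda>x1 x2. pure_tensor QH (quotient_map Q x1) (x2 * y)) (\<Delta> x)))"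

definition galois_extension ::
    "('k::field \<Rightarrow> 'h \<Rightarrow> 'h) \<Rightarrow> ('h \<Rightarrow> ('h \<times> 'h \<Rightarrow>\<^sub>0 'k) set) \<Rightarrow> ('k, 'h::ring_1 set) vspace
       \<Rightarrow> bool" where
  "galois_extension scale \<Delta> Q \<longleftrightarrow>
     bij_betw (canonical_map scale \<Delta> Q)
       (vcarrier (tensor_over scale (coinvariants scale \<Delta> Q)))
       (vcarrier (tensor Q (whole_space scale)))"

end

theory Submission
  imports Defs
begin

text \<open>
  For a right coideal subalgebra \<open>K\<close> two inclusions always hold: \<open>K\<close> lies in the coinvariants of
  \<open>H/HK\<^sup>+\<close>, and \<open>HK\<^sup>+ \<subseteq> I\<close> when \<open>K\<close> consists of the coinvariants of \<open>H/I\<close>. So the two maps are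
  mutually inverse iff the reverse inclusions hold. The first one is condition (2). The point is
  that the second one, for a given \<open>I\<close>, says exactly that \<open>H/I\<close> is Galois over its coinvariants.

  To see this, let \<open>\<beta>\<close> be the bijection \<open>x \<otimes> y \<mapsto> x\<^sub>1 \<otimes> x\<^sub>2 y\<close> of \<open>H \<otimes> H\<close>, with inverse
  \<open>x \<otimes> y \<mapsto> x\<^sub>1 \<otimes> S(x\<^sub>2) y\<close>. For every right coideal subalgebra \<open>K\<close> it carries the subspace
  spanned by all \<open>xa \<otimes> y - x \<otimes> ay\<close> with \<open>a \<in> K\<close> onto \<open>HK\<^sup>+ \<otimes> H\<close>, and hence induces an isomorphism
  \<open>H \<otimes>\<^sub>K H \<simeq> H/HK\<^sup>+ \<otimes> H\<close>. When \<open>K\<close> is the algebra of coinvariants of \<open>H/I\<close>, the canonical map is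
  this isomorphism followed by the surjection \<open>H/HK\<^sup>+ \<otimes> H \<rightarrow> H/I \<otimes> H\<close>. It is therefore always
  surjective, and it is injective iff \<open>HK\<^sup>+ = I\<close>; the two directions are the lemmas
  \<open>galois_kernel_left_ideal_plus\<close> and \<open>galois_kernel_subset_imp\<close>. That both maps take values in
  the right sets is shown by \<open>left_ideal_coideal_left_ideal_plus\<close> and
  \<open>right_coideal_subalgebra_coinv\<close>.

  Tensors are cosets of formal sums here, and are awkward to compute with. All computations are
  therefore dual: over a field, a formal sum lies in the span of a set of relations iff each linear
  form that kills the relations kills the sum (\<open>formal_span_iff\<close>). So a tensor in \<open>H \<otimes> H\<close> is
  determined by its values under bilinear forms on \<open>H\<close>, a tensor in \<open>H/I \<otimes> H\<close> by those forms
  that vanish on \<open>I \<times> H\<close>, and a tensor in \<open>H \<otimes>\<^sub>K H\<close> by the \<open>K\<close>-balanced forms. The scalar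
  \<open>sweedler \<phi> h\<close> is \<open>\<phi>(h\<^sub>1, h\<^sub>2)\<close>, and the Hopf algebra axioms, coideals, coinvariants and the
  canonical map are all restated in terms of it.
\<close>

section \<open>Formal sums and linear forms\<close>

lemma lookup_formal_scale [simp]:
  "Poly_Mapping.lookup (formal_scale c p) x = c * Poly_Mapping.lookup p x"
  by (simp add: formal_scale_def map.rep_eq when_def)

interpretation formal: vector_space "formal_scale :: 'k::field \<Rightarrow> ('x \<Rightarrow>\<^sub>0 'k) \<Rightarrow> ('x \<Rightarrow>\<^sub>0 'k)"
  by standard (auto intro!: poly_mapping_eqI simp: lookup_add algebra_simps)

lemma scalars_vector_space: "vector_space ((*) :: 'k::field \<Rightarrow> 'k \<Rightarrow> 'k)"
  by standard (auto simp: algebra_simps)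

text \<open>
  The linear extension of \<open>b\<close> from the basis to all formal sums. For a bilinear form \<open>b\<close> on
  \<open>A \<times> B\<close> it induces the corresponding functional on \<open>A \<otimes> B\<close>.
\<close>

definition formal_eval ::
    "('k::field \<Rightarrow> 'v::ab_group_add \<Rightarrow> 'v) \<Rightarrow> ('x \<Rightarrow> 'v) \<Rightarrow> ('x \<Rightarrow>\<^sub>0 'k) \<Rightarrow> 'v" where
  "formal_eval s b p = (\<Sum>x\<in>Poly_Mapping.keys p. s (Poly_Mapping.lookup p x) (b x))"

lemma formal_eval_superset:
  assumes "vector_space s" "finite A" "Poly_Mapping.keys p \<subseteq> A"
  shows "formal_eval s b p = (\<Sum>x\<in>A. s (Poly_Mapping.lookup p x) (b x))"
proof -
  interpret vector_space s by fact
  show ?thesis unfolding formal_eval_def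
    by (rule sum.mono_neutral_left) (use assms in \<open>auto simp: in_keys_iff\<close>)
qed

lemma linear_formal_eval:
  fixes s :: "'k::field \<Rightarrow> 'v::ab_group_add \<Rightarrow> 'v" and b :: "'x \<Rightarrow> 'v"
  assumes "vector_space s"
  shows "Vector_Spaces.linear formal_scale s (formal_eval s b)"
proof -
  interpret vector_space s by fact
  show ?thesis unfolding Vector_Spaces.linear_iff
  proof (intro conjI allI)
    fix p q :: "'x \<Rightarrow>\<^sub>0 'k" and c :: 'k
    let ?A = "Poly_Mapping.keys p \<union> Poly_Mapping.keys q"
    show "formal_eval s b (p + q) = formal_eval s b p + formal_eval s b q"
      by (simp add: formal_eval_superset[OF assms, of ?A] keys_add lookup_add
          scale_left_distrib sum.distrib)
    have "Poly_Mapping.keys (formal_scale c p) \<subseteq> Poly_Mapping.keys p"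
      by (auto simp: in_keys_iff)
    thus "formal_eval s b (formal_scale c p) = s c (formal_eval s b p)"
      by (simp add: formal_eval_superset[OF assms, of "Poly_Mapping.keys p"] scale_sum_right)
  qed (fact formal.vector_space_axioms assms)+
qed

lemma formal_eval_simps:
  assumes "vector_space s"
  shows formal_eval_0: "formal_eval s b 0 = 0"
    and formal_eval_add: "formal_eval s b (p + q) = formal_eval s b p + formal_eval s b q"
    and formal_eval_diff: "formal_eval s b (p - q) = formal_eval s b p - formal_eval s b q"
    and formal_eval_scale: "formal_eval s b (formal_scale c p) = s c (formal_eval s b p)"
    and formal_eval_single: "formal_eval s b (Poly_Mapping.single x 1) = b x"
proof -
  interpret l: Vector_Spaces.linear formal_scale s "formal_eval s b"
    by (rule linear_formal_eval) fact
  show "formal_eval s b 0 = 0" "formal_eval s b (p + q) = formal_eval s b p + formal_eval s b q"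
    "formal_eval s b (p - q) = formal_eval s b p - formal_eval s b q"
    "formal_eval s b (formal_scale c p) = s c (formal_eval s b p)"
    by (fact l.zero l.add l.diff l.scale)+
  show "formal_eval s b (Poly_Mapping.single x 1) = b x"
    by (simp add: formal_eval_def)
qed

lemmas scalar_eval_simps = formal_eval_simps[OF scalars_vector_space]

lemma formal_eval_cong:
  "(\<And>x. x \<in> Poly_Mapping.keys p \<Longrightarrow> b x = b' x) \<Longrightarrow> formal_eval s b p = formal_eval s b' p"
  by (simp add: formal_eval_def)

lemma linear_formal_eval_commute:
  assumes "Vector_Spaces.linear s t f"
  shows "f (formal_eval s b p) = formal_eval t (\<lambda>x. f (b x)) p"
proof -
  interpret Vector_Spaces.linear s t f by fact
  show ?thesis by (simp add: formal_eval_def sum scale)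
qed

lemma formal_eval_singles:
  "formal_eval formal_scale (\<lambda>x. Poly_Mapping.single x 1) p = (p :: 'x \<Rightarrow>\<^sub>0 'k::field)"
proof (rule poly_mapping_eqI)
  fix y
  have "Poly_Mapping.lookup (formal_eval formal_scale (\<lambda>x. Poly_Mapping.single x 1) p) y
     = (\<Sum>x\<in>Poly_Mapping.keys p. if x = y then Poly_Mapping.lookup p x else 0)"
    unfolding formal_eval_def lookup_sum by (rule sum.cong) (simp_all add: lookup_single when_def)
  also have "\<dots> = Poly_Mapping.lookup p y"
    by (simp add: in_keys_iff)
  finally show "Poly_Mapping.lookup (formal_eval formal_scale (\<lambda>x. Poly_Mapping.single x 1) p) y
     = Poly_Mapping.lookup p y" .
qed

lemma formal_eval_eval:
  assumes "vector_space s"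
  shows "formal_eval s \<phi> (formal_eval formal_scale b p) = formal_eval s (\<lambda>x. formal_eval s \<phi> (b x)) p"
  by (rule linear_formal_eval_commute[OF linear_formal_eval[OF assms]])

lemma formal_subspace_keys: "formal.subspace {p :: 'x \<Rightarrow>\<^sub>0 'k::field. Poly_Mapping.keys p \<subseteq> A}"
  by (auto simp: formal.subspace_def in_keys_iff lookup_add subset_iff)
    (metis add_0)

lemma formal_span_singles:
  "formal.span ((\<lambda>z. Poly_Mapping.single z 1) ` A) = {p :: 'x \<Rightarrow>\<^sub>0 'k::field. Poly_Mapping.keys p \<subseteq> A}"
proof
  show "formal.span ((\<lambda>z. Poly_Mapping.single z 1) ` A) \<subseteq> {p :: 'x \<Rightarrow>\<^sub>0 'k. Poly_Mapping.keys p \<subseteq> A}"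
    by (rule formal.span_minimal) (auto intro: formal_subspace_keys)
  show "{p :: 'x \<Rightarrow>\<^sub>0 'k. Poly_Mapping.keys p \<subseteq> A} \<subseteq> formal.span ((\<lambda>z. Poly_Mapping.single z 1) ` A)"
  proof
    fix p :: "'x \<Rightarrow>\<^sub>0 'k" assume "p \<in> {p. Poly_Mapping.keys p \<subseteq> A}"
    hence "formal_eval formal_scale (\<lambda>z. Poly_Mapping.single z 1) p
        \<in> formal.span ((\<lambda>z. Poly_Mapping.single z 1) ` A)"
      unfolding formal_eval_def
      by (intro formal.span_sum formal.span_scale formal.span_base) auto
    thus "p \<in> formal.span ((\<lambda>z. Poly_Mapping.single z 1) ` A)" by (simp add: formal_eval_singles)
  qed
qed

lemma keys_formal_eval_subset:
  assumes "\<And>x. x \<in> Poly_Mapping.keys p \<Longrightarrow> Poly_Mapping.keys (b x) \<subseteq> A"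
  shows "Poly_Mapping.keys (formal_eval formal_scale b p) \<subseteq> A"
proof -
  have "formal_eval formal_scale b p \<in> {q. Poly_Mapping.keys q \<subseteq> A}"
    unfolding formal_eval_def
    by (intro formal.subspace_sum formal.subspace_scale formal_subspace_keys) (use assms in auto)
  thus ?thesis by simp
qed

lemma (in vector_space) separating_functional:
  assumes "subspace N" "x \<notin> N"
  shows "\<exists>f. Vector_Spaces.linear scale (*) f \<and> (\<forall>v\<in>N. f v = 0) \<and> f x \<noteq> 0"
proof -
  interpret pair: vector_space_pair scale "(*) :: 'a \<Rightarrow> 'a \<Rightarrow> 'a"
    by (intro vector_space_pair.intro vector_space_axioms scalars_vector_space)
  obtain B where B: "B \<subseteq> N" "independent B" "N \<subseteq> span B"
    using maximal_independent_subset by blast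
  have "span B = N" using B assms by (simp add: span_subspace)
  hence "independent (insert x B)" using assms B by (simp add: independent_insertI)
  then obtain f where f: "Vector_Spaces.linear scale (*) f"
      "\<forall>v\<in>insert x B. f v = (if v = x then 1 else 0)"
    using pair.linear_independent_extend[of _ "\<lambda>v. if v = x then 1 else 0"] by blast
  have "f v = 0" if "v \<in> B" for v
    using f that B assms by (metis insertCI subset_iff)
  hence "f v = 0" if "v \<in> span B" for v
    using pair.linear_eq_0_on_span[OF f(1)] that by blast
  with f \<open>span B = N\<close> show ?thesis by (intro exI[of _ f]) auto
qed

lemma formal_eval_span_0:
  assumes "\<And>r. r \<in> R \<Longrightarrow> formal_eval (*) \<phi> r = 0" "p \<in> formal.span R"
  shows "formal_eval (*) \<phi> p = (0 :: 'k::field)"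
  using assms(2)
  by (induction rule: formal.span_induct_alt) (simp_all add: scalar_eval_simps assms(1))

text \<open>
  The tool by which equality of tensors is reduced to equality of scalars: over a field, subspaces
  are intersections of kernels of linear forms, and a linear form on formal sums is given by
  arbitrary values on the basis.
\<close>

lemma formal_span_iff:
  "p \<in> formal.span R \<longleftrightarrow>
     (\<forall>\<phi>. (\<forall>r\<in>R. formal_eval (*) \<phi> r = 0) \<longrightarrow> formal_eval (*) \<phi> p = (0 :: 'k::field))"
proof (intro iffI)
  assume *: "\<forall>\<phi>. (\<forall>r\<in>R. formal_eval (*) \<phi> r = 0) \<longrightarrow> formal_eval (*) \<phi> p = (0 :: 'k)"
  show "p \<in> formal.span R"
  proof (rule ccontr)
    assume "p \<notin> formal.span R"
    then obtain f where f: "Vector_Spaces.linear formal_scale (*) f"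
        "\<forall>v\<in>formal.span R. f v = 0" "f p \<noteq> 0"
      using formal.separating_functional formal.subspace_span by blast
    have f_eval: "f q = formal_eval (*) (\<lambda>x. f (Poly_Mapping.single x 1)) q" for q
      using linear_formal_eval_commute[OF f(1), of "\<lambda>x. Poly_Mapping.single x 1" q]
      by (simp add: formal_eval_singles)
    have "formal_eval (*) (\<lambda>x. f (Poly_Mapping.single x 1)) r = 0" if "r \<in> R" for r
      using f(2) f_eval[of r] formal.span_base[OF that] by simp
    with * have "f p = 0"
      unfolding f_eval[of p] by blast
    with f(3) show False by simp
  qed
qed (auto intro: formal_eval_span_0)

section \<open>Cosets and maps out of tensor products\<close>

context vector_space
begin

lemma coset_self: "subspace W \<Longrightarrow> v \<in> v +o W"
  using set_plus_intro2[of 0 W v] by (simp add: subspace_0)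

lemma coset_eq_iff:
  assumes "subspace W"
  shows "v +o W = w +o W \<longleftrightarrow> v - w \<in> W"
proof
  assume "v +o W = w +o W"
  with coset_self[OF assms, of v] show "v - w \<in> W" by (simp add: set_minus_plus)
next
  assume *: "v - w \<in> W"
  have "v +o W \<subseteq> w +o W" if "v - w \<in> W" for v w
  proof
    fix x assume "x \<in> v +o W"
    hence "x - v \<in> W" by (simp add: set_minus_plus)
    hence "x - w \<in> W" using subspace_add[OF assms _ that, of "x - v"] by simp
    thus "x \<in> w +o W" by (simp add: set_minus_plus)
  qed
  from this[OF *] this[of w v] show "v +o W = w +o W"
    using * subspace_neg[OF assms *] by auto
qed

lemma subspace_plus_self: "subspace W \<Longrightarrow> W + W = W"
  by (auto simp: set_plus_def subspace_add) (metis add_0 subspace_0)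

lemma coset_add: "subspace W \<Longrightarrow> (v +o W) + (w +o W) = (v + w) +o W"
  by (simp add: set_plus_rearrange subspace_plus_self)

lemma coset_scale:
  assumes "subspace W"
  shows "scale c ` (v +o W) + W = scale c v +o W"
proof -
  have "scale c ` (v +o W) + W \<subseteq> scale c v +o W"
  proof
    fix x assume "x \<in> scale c ` (v +o W) + W"
    then obtain w w' where "w \<in> W" "w' \<in> W" "x = scale c (v + w) + w'"
      by (auto simp: set_plus_def elt_set_plus_def)
    thus "x \<in> scale c v +o W"
      by (auto simp: elt_set_plus_def scale_right_distrib add.assoc
          intro!: bexI[of _ "scale c w + w'"] subspace_add subspace_scale assms)
  qed
  moreover have "scale c v +o W \<subseteq> scale c ` (v +o W) + W"
    using coset_self[OF assms, of v] by (intro set_plus_mono3) auto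
  ultimately show ?thesis by auto
qed

lemma coset_representative:
  "subspace W \<Longrightarrow> (SOME v. v \<in> x +o W) - x \<in> W"
  using someI[of "\<lambda>v. v \<in> x +o W", OF coset_self] by (simp add: set_minus_plus)

lemma coset_sum:
  assumes "subspace W" "finite A"
  shows "W + (\<Sum>x\<in>A. f x +o W) = (\<Sum>x\<in>A. f x) +o W"
  using assms(2)
proof (induction A rule: finite_induct)
  case (insert x A)
  have "W + (\<Sum>x\<in>insert x A. f x +o W) = (f x +o W) + (W + (\<Sum>x\<in>A. f x +o W))"
    unfolding sum.insert[OF insert.hyps] by (rule add.left_commute)
  then show ?case using insert assms(1) by (simp add: coset_add)
qed simp

end

lemma quotient_space_simps [simp]:
  "vcarrier (quotient_space V s W) = (\<lambda>v. v +o W) ` V"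
  "vzero (quotient_space V s W) = W"
  "vscale (quotient_space V s W) c X = s c ` X + W"
  by (simp_all add: quotient_space_def)

lemma whole_space_simps [simp]:
  "vcarrier (whole_space s) = UNIV" "vzero (whole_space s) = 0" "vscale (whole_space s) = s"
  by (simp_all add: whole_space_def)

lemma tensor_lift_whole_space:
  "tensor_lift (whole_space s) b X = formal_eval s (\<lambda>(x, y). b x y) (SOME p. p \<in> X)"
  by (simp add: tensor_lift_def whole_space_def formal_eval_def Let_def split_def)

text \<open>
  The value is left in terms of the one representative of \<open>X\<close> that is picked. Its independence of
  this choice is settled later by applying linear forms, where it becomes bilinearity of a scalar
  function and no statement about classes of formal sums is involved.
\<close>

lemma tensor_lift_quotient_space:
  assumes "vector_space s" "module.subspace s W"
    and "\<And>x y. (x, y) \<in> Poly_Mapping.keys (SOME p. p \<in> X) \<Longrightarrow> b x y = \<beta> x y +o W"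
  shows "tensor_lift (quotient_space V s W) b X =
     formal_eval s (\<lambda>(x, y). \<beta> x y) (SOME p. p \<in> X) +o W"
proof -
  interpret vector_space s by fact
  define p where "p = (SOME p. p \<in> X)"
  have "tensor_lift (quotient_space V s W) b X =
     W + (\<Sum>(x, y)\<in>Poly_Mapping.keys p. s (Poly_Mapping.lookup p (x, y)) ` b x y + W)"
    by (simp add: tensor_lift_def quotient_space_def Let_def p_def)
  also have "\<dots> = W + (\<Sum>z\<in>Poly_Mapping.keys p.
       s (Poly_Mapping.lookup p z) ((\<lambda>(x, y). \<beta> x y) z) +o W)"
    using assms(2,3) by (intro arg_cong2[where f = "(+)"] sum.cong) (auto simp: p_def coset_scale)
  also have "\<dots> = formal_eval s (\<lambda>(x, y). \<beta> x y) p +o W"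
    by (simp add: coset_sum assms formal_eval_def)
  finally show ?thesis by (simp add: p_def)
qed

section \<open>Tensors tested by bilinear forms\<close>

text \<open>
  Forms that kill the relations of a tensor product are the forms that are bilinear on the
  carriers.
\<close>

lemma formal_eval_bilinear_relations:
  "(\<forall>r\<in>bilinear_relations M N. formal_eval (*) (\<lambda>(x, y). \<phi> x y) r = (0 :: 'k::field)) \<longleftrightarrow>
     (\<forall>x\<in>vcarrier M. \<forall>x'\<in>vcarrier M. \<forall>y\<in>vcarrier N. \<phi> (x + x') y = \<phi> x y + \<phi> x' y) \<and>
     (\<forall>x\<in>vcarrier M. \<forall>y\<in>vcarrier N. \<forall>y'\<in>vcarrier N. \<phi> x (y + y') = \<phi> x y + \<phi> x y') \<and>
     (\<forall>c. \<forall>x\<in>vcarrier M. \<forall>y\<in>vcarrier N. \<phi> (vscale M c x) y = c * \<phi> x y) \<and>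
     (\<forall>c. \<forall>x\<in>vcarrier M. \<forall>y\<in>vcarrier N. \<phi> x (vscale N c y) = c * \<phi> x y)"
proof -
  have image: "(\<forall>r\<in>{g x x' y | x x' y. P x x' y}. Q r) \<longleftrightarrow> (\<forall>x x' y. P x x' y \<longrightarrow> Q (g x x' y))"
    for g :: "'x \<Rightarrow> 'y \<Rightarrow> 'z \<Rightarrow> 'w" and P Q by blast
  show ?thesis
    unfolding bilinear_relations_def ball_Un image
    by (auto simp: scalar_eval_simps diff_diff_eq)
qed

lemma tensor_eq_quotient_space:
  "tensor M N = quotient_space {p. Poly_Mapping.keys p \<subseteq> vcarrier M \<times> vcarrier N} formal_scale
     (formal.span (bilinear_relations M N))"
  by (simp add: tensor_def formal_sums_mod_def)

lemma pure_tensor_tensor: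
  "pure_tensor (tensor M N) x y =
     Poly_Mapping.single (x, y) 1 +o formal.span (bilinear_relations M N)"
  by (simp add: pure_tensor_def tensor_eq_quotient_space)

lemma tensor_lift_tensor:
  assumes "\<And>x y. (x, y) \<in> Poly_Mapping.keys (SOME p. p \<in> X) \<Longrightarrow>
      b x y = \<beta> x y +o formal.span (bilinear_relations M N)"
  shows "tensor_lift (tensor M N) b X =
    formal_eval formal_scale (\<lambda>(x, y). \<beta> x y) (SOME p. p \<in> X) +o formal.span (bilinear_relations M N)"
  unfolding tensor_eq_quotient_space
  by (rule tensor_lift_quotient_space) (use assms in \<open>auto intro: formal.vector_space_axioms\<close>)

lemma tensor_coset_eqD:
  assumes "p +o formal.span (bilinear_relations M N) = q +o formal.span (bilinear_relations M N)"
    and "\<forall>r\<in>bilinear_relations M N. formal_eval (*) \<phi> r = (0 :: 'k::field)"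
  shows "formal_eval (*) \<phi> p = formal_eval (*) \<phi> q"
proof -
  have "p - q \<in> formal.span (bilinear_relations M N)"
    using assms(1) by (simp add: formal.coset_eq_iff)
  hence "formal_eval (*) \<phi> (p - q) = 0"
    using assms(2) formal_eval_span_0 by blast
  thus ?thesis by (simp add: scalar_eval_simps)
qed

context coalgebra_over
begin

abbreviation linear_form :: "('h \<Rightarrow> 'k) \<Rightarrow> bool" where
  "linear_form \<equiv> Vector_Spaces.linear scale (*)"

lemma linear_form_iff:
  fixes f :: "'h \<Rightarrow> 'k"
  shows "linear_form f \<longleftrightarrow> (\<forall>x y. f (x + y) = f x + f y) \<and> (\<forall>c x. f (scale c x) = c * f x)"
  by (simp add: Vector_Spaces.linear_iff scalars_vector_space vector_space_axioms)

definition bilinear_form :: "('h \<Rightarrow> 'h \<Rightarrow> 'k) \<Rightarrow> bool" where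
  "bilinear_form \<phi> \<longleftrightarrow>
     (\<forall>x x' y. \<phi> (x + x') y = \<phi> x y + \<phi> x' y) \<and> (\<forall>x y y'. \<phi> x (y + y') = \<phi> x y + \<phi> x y') \<and>
     (\<forall>c x y. \<phi> (scale c x) y = c * \<phi> x y) \<and> (\<forall>c x y. \<phi> x (scale c y) = c * \<phi> x y)"

abbreviation square_relations :: "('h \<times> 'h \<Rightarrow>\<^sub>0 'k) set" where
  "square_relations \<equiv> formal.span (bilinear_relations (whole_space scale) (whole_space scale))"

lemma bilinear_form_relations:
  "(\<forall>r\<in>bilinear_relations (whole_space scale) (whole_space scale).
      formal_eval (*) (\<lambda>(x, y). \<phi> x y) r = 0) \<longleftrightarrow> bilinear_form \<phi>"
  by (simp add: formal_eval_bilinear_relations bilinear_form_def)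

lemma bilinear_formD:
  assumes "bilinear_form \<phi>"
  shows "\<phi> (x + x') y = \<phi> x y + \<phi> x' y" "\<phi> x (y + y') = \<phi> x y + \<phi> x y'"
    "\<phi> (scale c x) y = c * \<phi> x y" "\<phi> x (scale c y) = c * \<phi> x y"
    "\<phi> (x - x') y = \<phi> x y - \<phi> x' y" "\<phi> x (y - y') = \<phi> x y - \<phi> x y'"
    "\<phi> 0 y = 0" "\<phi> x 0 = 0"
proof -
  show add: "\<phi> (x + x') y = \<phi> x y + \<phi> x' y" "\<phi> x (y + y') = \<phi> x y + \<phi> x y'" for x x' y y'
    using assms by (auto simp: bilinear_form_def)
  show scale: "\<phi> (scale c x) y = c * \<phi> x y" "\<phi> x (scale c y) = c * \<phi> x y" for c x y
    using assms by (auto simp: bilinear_form_def)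
  show "\<phi> (x - x') y = \<phi> x y - \<phi> x' y" "\<phi> x (y - y') = \<phi> x y - \<phi> x y'"
    by (simp_all add: eq_diff_eq flip: add)
  show "\<phi> 0 y = 0" "\<phi> x 0 = 0"
    using scale(1)[of 0 0 y] scale(2)[of x 0 0] by simp_all
qed

lemma linear_form_bilinear:
  "bilinear_form \<phi> \<Longrightarrow> linear_form (\<lambda>x. \<phi> x y)" "bilinear_form \<phi> \<Longrightarrow> linear_form (\<phi> x)"
  by (simp_all add: bilinear_form_def linear_form_iff)

definition square_eval :: "('h \<Rightarrow> 'h \<Rightarrow> 'k) \<Rightarrow> ('h \<times> 'h \<Rightarrow>\<^sub>0 'k) set \<Rightarrow> 'k" where
  "square_eval \<phi> X = formal_eval (*) (\<lambda>(x, y). \<phi> x y) (SOME p. p \<in> X)"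

lemma square_eval_coset:
  assumes "bilinear_form \<phi>"
  shows "square_eval \<phi> (p +o square_relations) = formal_eval (*) (\<lambda>(x, y). \<phi> x y) p"
proof -
  have "formal_eval (*) (\<lambda>(x, y). \<phi> x y) ((SOME q. q \<in> p +o square_relations) - p) = 0"
    by (rule formal_eval_span_0[OF _ formal.coset_representative])
      (use assms bilinear_form_relations in auto)
  thus ?thesis by (simp add: square_eval_def scalar_eval_simps)
qed

lemma vzero_square: "vzero (tensor_square scale) = square_relations"
  by (simp add: tensor_eq_quotient_space)

lemma square_carrierE:
  assumes "X \<in> vcarrier (tensor_square scale)"
  obtains p where "X = p +o square_relations"
  using assms by (auto simp: tensor_eq_quotient_space)

lemma square_eval_add:
  assumes "bilinear_form \<phi>" "X \<in> vcarrier (tensor_square scale)" "Y \<in> vcarrier (tensor_square scale)"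
  shows "square_eval \<phi> (X + Y) = square_eval \<phi> X + square_eval \<phi> Y"
  using assms
  by (auto elim!: square_carrierE simp: formal.coset_add square_eval_coset scalar_eval_simps)

lemma square_eval_scale:
  assumes "bilinear_form \<phi>" "X \<in> vcarrier (tensor_square scale)"
  shows "square_eval \<phi> (vscale (tensor_square scale) c X) = c * square_eval \<phi> X"
proof -
  from assms(2) obtain p where p: "X = p +o square_relations" by (rule square_carrierE)
  have "vscale (tensor_square scale) c X = formal_scale c p +o square_relations"
    by (simp add: tensor_eq_quotient_space p formal.coset_scale)
  thus ?thesis using assms by (simp add: p square_eval_coset scalar_eval_simps)
qed

lemma square_eval_pure:
  "bilinear_form \<phi> \<Longrightarrow> square_eval \<phi> (pure_tensor (tensor_square scale) x y) = \<phi> x y"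
  by (simp add: pure_tensor_tensor square_eval_coset scalar_eval_simps)

section \<open>Hopf algebra axioms in terms of bilinear forms\<close>

lemma comult_rep_exists:
  "\<exists>\<delta>. Vector_Spaces.linear scale formal_scale \<delta> \<and> (\<forall>h. \<Delta> h = \<delta> h +o square_relations)"
proof -
  interpret pair: vector_space_pair scale "formal_scale :: 'k \<Rightarrow> ('h \<times> 'h \<Rightarrow>\<^sub>0 'k) \<Rightarrow> _"
    by (intro vector_space_pair.intro vector_space_axioms formal.vector_space_axioms)
  have "\<exists>p. \<Delta> h = p +o square_relations" for h
    using comult_carrier square_carrierE by metis
  then obtain r where r: "\<And>h. \<Delta> h = r h +o square_relations" by metis
  obtain B where B: "independent B" "UNIV \<subseteq> span B"
    by (rule maximal_independent_subset[of UNIV])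
  obtain \<delta> where \<delta>: "Vector_Spaces.linear scale formal_scale \<delta>" "\<forall>b\<in>B. \<delta> b = r b"
    using pair.linear_independent_extend[OF B(1), of r] by blast
  interpret \<delta>: Vector_Spaces.linear scale formal_scale \<delta> by fact
  have \<Delta>_scale: "\<Delta> (scale c x) = formal_scale c p +o square_relations"
    if "\<Delta> x = p +o square_relations" for c x p
    unfolding comult_scale that by (simp add: tensor_eq_quotient_space formal.coset_scale)
  have "\<Delta> h = \<delta> h +o square_relations" for h
  proof -
    have "h \<in> span B" using B by auto
    thus ?thesis
    proof (induction h rule: span_induct_alt)
      case base
      show ?case using \<Delta>_scale[OF r, of 0 0] by simp
    next
      case (step c x y)
      hence "\<Delta> x = \<delta> x +o square_relations" using \<delta>(2) r by simp
      thus ?case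
        by (simp add: comult_add \<Delta>_scale step formal.coset_add \<delta>.add \<delta>.scale)
    qed
  qed
  with \<delta>(1) show ?thesis by blast
qed

text \<open>
  A representative of \<open>\<Delta> h\<close> that depends linearly on \<open>h\<close>, so that \<open>\<phi>(h\<^sub>1, h\<^sub>2)\<close> is linear in \<open>h\<close>
  even before \<open>\<phi>\<close> is known to be bilinear. This makes nested expressions easy to simplify.
\<close>

definition comult_rep :: "'h \<Rightarrow> ('h \<times> 'h \<Rightarrow>\<^sub>0 'k)" where
  "comult_rep = (SOME \<delta>. Vector_Spaces.linear scale formal_scale \<delta> \<and>
     (\<forall>h. \<Delta> h = \<delta> h +o square_relations))"

lemma linear_comult_rep: "Vector_Spaces.linear scale formal_scale comult_rep"
  and comult_eq_comult_rep: "\<Delta> h = comult_rep h +o square_relations"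
  using someI_ex[OF comult_rep_exists] unfolding comult_rep_def[symmetric] by blast+

text \<open>
  \<open>\<phi>(h\<^sub>1, h\<^sub>2)\<close> in Sweedler notation; nesting it gives iterated comultiplications.
\<close>

definition sweedler :: "('h \<Rightarrow> 'h \<Rightarrow> 'k) \<Rightarrow> 'h \<Rightarrow> 'k" where
  "sweedler \<phi> h = formal_eval (*) (\<lambda>(x, y). \<phi> x y) (comult_rep h)"

lemma sweedler_arg [simp]:
  "sweedler \<phi> (x + y) = sweedler \<phi> x + sweedler \<phi> y"
  "sweedler \<phi> (x - y) = sweedler \<phi> x - sweedler \<phi> y"
  "sweedler \<phi> (scale c x) = c * sweedler \<phi> x"
proof -
  interpret l: Vector_Spaces.linear scale formal_scale comult_rep by (rule linear_comult_rep)
  show "sweedler \<phi> (x + y) = sweedler \<phi> x + sweedler \<phi> y"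
    "sweedler \<phi> (x - y) = sweedler \<phi> x - sweedler \<phi> y"
    "sweedler \<phi> (scale c x) = c * sweedler \<phi> x"
    by (simp_all add: sweedler_def l.add l.diff l.scale scalar_eval_simps)
qed

lemma sweedler_form [simp]:
  "sweedler (\<lambda>a b. \<phi> a b + \<psi> a b) h = sweedler \<phi> h + sweedler \<psi> h"
  "sweedler (\<lambda>a b. \<phi> a b - \<psi> a b) h = sweedler \<phi> h - sweedler \<psi> h"
  "sweedler (\<lambda>a b. c * \<phi> a b) h = c * sweedler \<phi> h"
  "sweedler (\<lambda>a b. \<phi> a b * c) h = sweedler \<phi> h * c"
  "sweedler (\<lambda>a b. 0) h = 0"
  by (simp_all add: sweedler_def formal_eval_def split_def algebra_simps sum.distrib
      sum_subtractf sum_distrib_left)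

lemma sweedler_0 [simp]: "sweedler \<phi> 0 = 0"
  using sweedler_arg(3)[of \<phi> 0 0] by simp

lemma sweedler_swap:
  "sweedler (\<lambda>a b. sweedler (\<lambda>c d. f a b c d) y) x = sweedler (\<lambda>c d. sweedler (\<lambda>a b. f a b c d) x) y"
  by (simp add: sweedler_def formal_eval_def split_def sum_distrib_left algebra_simps)
    (rule sum.swap)

lemma square_eval_comult: "bilinear_form \<phi> \<Longrightarrow> square_eval \<phi> (\<Delta> h) = sweedler \<phi> h"
  by (simp add: comult_eq_comult_rep square_eval_coset sweedler_def)

lemma sweedler_eqI:
  "bilinear_form \<phi> \<Longrightarrow> \<Delta> h = p +o square_relations \<Longrightarrow>
     sweedler \<phi> h = formal_eval (*) (\<lambda>(x, y). \<phi> x y) p"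
  by (simp add: square_eval_coset flip: square_eval_comult)

lemma counit_simps [simp]:
  "\<epsilon> (x + y) = \<epsilon> x + \<epsilon> y" "\<epsilon> (x - y) = \<epsilon> x - \<epsilon> y" "\<epsilon> (scale c x) = c * \<epsilon> x" "\<epsilon> 0 = 0"
proof -
  interpret l: Vector_Spaces.linear scale "(*)" \<epsilon> by (rule counit_linear)
  show "\<epsilon> (x + y) = \<epsilon> x + \<epsilon> y" "\<epsilon> (x - y) = \<epsilon> x - \<epsilon> y" "\<epsilon> (scale c x) = c * \<epsilon> x" "\<epsilon> 0 = 0"
    by (fact l.add l.diff l.scale l.zero)+
qed

text \<open>
  Turns the axioms that are equations in \<open>H\<close> (counit and antipode) into equations of scalars.
\<close>

lemma sweedler_lift:
  assumes "tensor_lift (whole_space scale) b (\<Delta> h) = v" "linear_form f"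
    "bilinear_form (\<lambda>x y. f (b x y))"
  shows "sweedler (\<lambda>x y. f (b x y)) h = f v"
  using linear_formal_eval_commute[OF assms(2), of "\<lambda>(x, y). b x y" "SOME p. p \<in> \<Delta> h"] assms
  by (simp add: tensor_lift_whole_space split_def flip: square_eval_comult)
    (simp add: square_eval_def split_def)

lemma sweedler_counit:
  assumes "linear_form f"
  shows sweedler_counit_left: "sweedler (\<lambda>x y. \<epsilon> x * f y) h = f h"
    and sweedler_counit_right: "sweedler (\<lambda>x y. f x * \<epsilon> y) h = f h"
proof -
  from assms have f: "f (x + y) = f x + f y" "f (scale c x) = c * f x" for c x y
    by (simp_all add: linear_form_iff)
  show "sweedler (\<lambda>x y. \<epsilon> x * f y) h = f h"
    using sweedler_lift[OF counit_left assms] by (simp add: bilinear_form_def f algebra_simps)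
  show "sweedler (\<lambda>x y. f x * \<epsilon> y) h = f h"
    using sweedler_lift[OF counit_right assms]
    by (simp add: bilinear_form_def f algebra_simps)
qed

text \<open>
  The two sides of the axiom live in \<open>H \<otimes> (H \<otimes> H)\<close>. Evaluating a trilinear form on them takes two
  forms on mixed tensor products: \<open>\<Phi>\<close> on \<open>H \<otimes> (H \<otimes> H)\<close>, and \<open>\<Psi>\<close> on \<open>(H \<otimes> H) \<otimes> H\<close>, where the left-hand
  side starts before it is reassociated.
\<close>

lemma sweedler_coassoc:
  assumes left: "\<And>z. bilinear_form (\<lambda>x y. f x y z)" and right: "\<And>x. bilinear_form (f x)"
  shows "sweedler (\<lambda>x y. sweedler (\<lambda>a b. f a b y) x) h =
    sweedler (\<lambda>x y. sweedler (\<lambda>a b. f x a b) y) h"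
proof -
  define HH where "HH = tensor_square scale"
  define R where "R = (SOME p. p \<in> \<Delta> h)"
  define W1 where "W1 = formal.span (bilinear_relations HH (whole_space scale))"
  define W2 where "W2 = formal.span (bilinear_relations (whole_space scale) HH)"
  define Y where "Y = formal_eval formal_scale (\<lambda>(x, y). Poly_Mapping.single (\<Delta> x, y) 1) R +o W1"
  define L where "L = formal_eval formal_scale (\<lambda>(t, z). formal_eval formal_scale
    (\<lambda>(x, y). Poly_Mapping.single (x, pure_tensor HH y z) 1) (SOME p. p \<in> t)) (SOME p. p \<in> Y)"
  define L' where "L' = formal_eval formal_scale (\<lambda>(x, y). Poly_Mapping.single (x, \<Delta> y) 1) R"
  \<comment> \<open>The two forms on the mixed tensor products; both evaluate the inner tensor first.\<close>
  define \<Phi> where "\<Phi> x t = square_eval (f x) t" for x t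
  define \<Psi> where "\<Psi> t z = square_eval (\<lambda>x y. f x y z) t" for t z
  have f: "f (x + x') y z = f x y z + f x' y z" "f x (y + y') z = f x y z + f x y' z"
    "f x y (z + z') = f x y z + f x y z'" "f (scale c x) y z = c * f x y z"
    "f x (scale c y) z = c * f x y z" "f x y (scale c z) = c * f x y z" for c x x' y y' z z'
    using bilinear_formD[OF left] bilinear_formD[OF right] by auto
  have f_ext: "f (x + x') = (\<lambda>y z. f x y z + f x' y z)" "f (scale c x) = (\<lambda>y z. c * f x y z)"
    for c x x'
    by (simp_all add: fun_eq_iff f)
  have "tensor_lift (tensor HH (whole_space scale))
      (\<lambda>x y. pure_tensor (tensor HH (whole_space scale)) (\<Delta> x) y) (\<Delta> h) = Y"
    unfolding Y_def R_def W1_def by (rule tensor_lift_tensor) (simp add: pure_tensor_tensor)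
  moreover have "tensor_assoc scale Y = L +o W2"
    unfolding tensor_assoc_def Let_def L_def W2_def HH_def[symmetric]
    by (rule tensor_lift_tensor tensor_lift_tensor[where \<beta> = "\<lambda>x y. Poly_Mapping.single (x, pure_tensor HH y z) 1" for z])+
      (simp add: pure_tensor_tensor)
  moreover have "tensor_lift (tensor (whole_space scale) HH)
      (\<lambda>x y. pure_tensor (tensor (whole_space scale) HH) x (\<Delta> y)) (\<Delta> h) = L' +o W2"
    unfolding L'_def R_def W2_def by (rule tensor_lift_tensor) (simp add: pure_tensor_tensor)
  ultimately have eq: "L +o W2 = L' +o W2"
    using coassoc[of h] by (simp add: HH_def)
  have eval_R: "formal_eval (*) (\<lambda>(x, y). \<phi> x y) R = sweedler \<phi> h" if "bilinear_form \<phi>" for \<phi>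
    using square_eval_comult[OF that, of h] by (simp add: R_def square_eval_def)
  have \<Phi>: "\<forall>r\<in>bilinear_relations (whole_space scale) HH. formal_eval (*) (\<lambda>(x, t). \<Phi> x t) r = 0"
    unfolding formal_eval_bilinear_relations \<Phi>_def HH_def
    by (simp add: square_eval_add square_eval_scale right)
      (simp add: square_eval_def formal_eval_def f split_def algebra_simps sum.distrib sum_distrib_left)
  have \<Psi>: "\<forall>r\<in>bilinear_relations HH (whole_space scale). formal_eval (*) (\<lambda>(t, z). \<Psi> t z) r = 0"
    unfolding formal_eval_bilinear_relations \<Psi>_def HH_def
    by (simp add: square_eval_add square_eval_scale left)
      (simp add: square_eval_def formal_eval_def f split_def algebra_simps sum.distrib sum_distrib_left)
  have "formal_eval (*) (\<lambda>(x, t). \<Phi> x t) L' = formal_eval (*) (\<lambda>(x, y). sweedler (\<lambda>a b. f x a b) y) R"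
    unfolding L'_def
    by (simp add: formal_eval_eval scalars_vector_space split_def scalar_eval_simps)
      (simp add: \<Phi>_def square_eval_comult right)
  also have "\<dots> = sweedler (\<lambda>x y. sweedler (\<lambda>a b. f x a b) y) h"
    by (rule eval_R) (simp add: bilinear_form_def f f_ext)
  finally have 1: "formal_eval (*) (\<lambda>(x, t). \<Phi> x t) L' = sweedler (\<lambda>x y. sweedler (\<lambda>a b. f x a b) y) h" .
  have "formal_eval (*) (\<lambda>(x, t). \<Phi> x t) L = formal_eval (*) (\<lambda>(t, z). \<Psi> t z) (SOME p. p \<in> Y)"
    unfolding L_def
    by (simp add: formal_eval_eval scalars_vector_space split_def scalar_eval_simps)
      (simp add: \<Phi>_def \<Psi>_def HH_def square_eval_pure right, simp add: square_eval_def split_def)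
  also have "\<dots> = formal_eval (*) (\<lambda>(t, z). \<Psi> t z)
      (formal_eval formal_scale (\<lambda>(x, y). Poly_Mapping.single (\<Delta> x, y) 1) R)"
  proof -
    \<comment> \<open>The representative picked from \<open>Y\<close> differs from \<open>?q\<close> by relations, which \<open>\<Psi>\<close> kills.\<close>
    let ?q = "formal_eval formal_scale (\<lambda>(x, y). Poly_Mapping.single (\<Delta> x, y) 1) R"
    have "(SOME p. p \<in> Y) - ?q \<in> W1"
      unfolding Y_def W1_def by (rule formal.coset_representative) simp
    hence "(SOME p. p \<in> Y) +o W1 = ?q +o W1"
      unfolding W1_def by (simp add: formal.coset_eq_iff)
    thus ?thesis using \<Psi> unfolding W1_def by (rule tensor_coset_eqD)
  qed
  also have "\<dots> = formal_eval (*) (\<lambda>(x, y). sweedler (\<lambda>a b. f a b y) x) R"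
    by (simp add: formal_eval_eval scalars_vector_space split_def scalar_eval_simps)
      (simp add: \<Psi>_def square_eval_comult left)
  also have "\<dots> = sweedler (\<lambda>x y. sweedler (\<lambda>a b. f a b y) x) h"
    by (rule eval_R) (simp add: bilinear_form_def f)
  finally show ?thesis
    using tensor_coset_eqD[OF eq[unfolded W2_def] \<Phi>] 1 by simp
qed

end

context bialgebra_over
begin

lemmas mult_simps = distrib_left distrib_right scale_mult_left[symmetric] scale_mult_right[symmetric]

lemma sweedler_mult:
  assumes "bilinear_form \<phi>"
  shows "sweedler \<phi> (g * h) = sweedler (\<lambda>a b. sweedler (\<lambda>c d. \<phi> (a * c) (b * d)) h) g"
proof -
  note \<phi> = bilinear_formD[OF assms]
  have "\<Delta> (g * h) = formal_eval formal_scale (\<lambda>(a, b). formal_eval formal_scale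
      (\<lambda>(c, d). Poly_Mapping.single (a * c, b * d) 1) (SOME p. p \<in> \<Delta> h)) (SOME p. p \<in> \<Delta> g) +o square_relations"
    unfolding comult_mult tensor_mult_def Let_def
    by (rule tensor_lift_tensor tensor_lift_tensor[where \<beta> = "\<lambda>c d. Poly_Mapping.single (a * c, b * d) 1" for a b])+
      (simp add: pure_tensor_tensor)
  from sweedler_eqI[OF assms this]
  have "sweedler \<phi> (g * h) = square_eval (\<lambda>a b. square_eval (\<lambda>c d. \<phi> (a * c) (b * d)) (\<Delta> h)) (\<Delta> g)"
    by (simp add: formal_eval_eval scalars_vector_space split_def scalar_eval_simps square_eval_def)
  also have "\<dots> = sweedler (\<lambda>a b. sweedler (\<lambda>c d. \<phi> (a * c) (b * d)) h) g"
    by (simp add: square_eval_comult bilinear_form_def mult_simps \<phi>)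
  finally show ?thesis .
qed

lemma sweedler_one: "bilinear_form \<phi> \<Longrightarrow> sweedler \<phi> 1 = \<phi> 1 1"
  by (simp add: comult_one square_eval_pure flip: square_eval_comult)

end

context hopf_algebra
begin

lemma antipode_simps [simp]:
  "S (x + y) = S x + S y" "S (x - y) = S x - S y" "S (scale c x) = scale c (S x)"
proof -
  interpret l: Vector_Spaces.linear scale scale S by (rule antipode_linear)
  show "S (x + y) = S x + S y" "S (x - y) = S x - S y" "S (scale c x) = scale c (S x)"
    by (fact l.add l.diff l.scale)+
qed

lemma sweedler_antipode:
  assumes "linear_form f"
  shows sweedler_antipode_left: "sweedler (\<lambda>x y. f (S x * y)) h = \<epsilon> h * f 1"
    and sweedler_antipode_right: "sweedler (\<lambda>x y. f (x * S y)) h = \<epsilon> h * f 1"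
proof -
  from assms have f: "f (x + y) = f x + f y" "f (scale c x) = c * f x" for c x y
    by (simp_all add: linear_form_iff)
  show "sweedler (\<lambda>x y. f (S x * y)) h = \<epsilon> h * f 1"
    using sweedler_lift[OF antipode_left assms] by (simp add: bilinear_form_def f mult_simps)
  show "sweedler (\<lambda>x y. f (x * S y)) h = \<epsilon> h * f 1"
    using sweedler_lift[OF antipode_right assms] by (simp add: bilinear_form_def f mult_simps)
qed

text \<open>
  Apply \<open>\<epsilon>\<close> to \<open>S(h\<^sub>1) h\<^sub>2 = \<epsilon>(h) 1\<close> and absorb the factor \<open>\<epsilon>(h\<^sub>2)\<close> by the counit axiom.
\<close>

lemma counit_antipode: "\<epsilon> (S h) = \<epsilon> h"
proof -
  have "sweedler (\<lambda>x y. \<epsilon> (S x * y)) h = \<epsilon> h"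
    using sweedler_antipode_left[OF counit_linear] by (simp add: counit_one)
  moreover have "sweedler (\<lambda>x y. \<epsilon> (S x) * \<epsilon> y) h = \<epsilon> (S h)"
    by (rule sweedler_counit_right) (simp add: linear_form_iff)
  ultimately show ?thesis by (simp add: counit_mult)
qed

end

context coalgebra_over
begin

section \<open>Coideals and coinvariants in terms of bilinear forms\<close>

text \<open>
  Both conditions say that \<open>\<Delta> h\<close> is a sum of pure tensors \<open>x \<otimes> y\<close> with \<open>(x, y) \<in> A\<close>: adding these pure
  tensors to the relations leaves exactly the bilinear forms that vanish on \<open>A\<close>. Right coideals are
  the case \<open>A = K \<times> H\<close>, coideals the case \<open>A = I \<times> H \<union> H \<times> I\<close>.
\<close>

lemma comult_supported_iff:
  "(\<exists>p. Poly_Mapping.keys p \<subseteq> A \<and> \<Delta> h = p +o square_relations) \<longleftrightarrow>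
     (\<forall>\<phi>. bilinear_form \<phi> \<longrightarrow> (\<forall>(x, y)\<in>A. \<phi> x y = 0) \<longrightarrow> sweedler \<phi> h = 0)"
proof (intro iffI allI impI)
  fix \<phi> assume "\<exists>p. Poly_Mapping.keys p \<subseteq> A \<and> \<Delta> h = p +o square_relations"
    and \<phi>: "bilinear_form \<phi>" "\<forall>(x, y)\<in>A. \<phi> x y = 0"
  then obtain p where p: "Poly_Mapping.keys p \<subseteq> A" "\<Delta> h = p +o square_relations" by blast
  have "formal_eval (*) (\<lambda>(x, y). \<phi> x y) p = 0"
    unfolding formal_eval_def by (rule sum.neutral) (use p(1) \<phi>(2) in auto)
  thus "sweedler \<phi> h = 0" using sweedler_eqI[OF \<phi>(1) p(2)] by simp
next
  assume *: "\<forall>\<phi>. bilinear_form \<phi> \<longrightarrow> (\<forall>(x, y)\<in>A. \<phi> x y = 0) \<longrightarrow> sweedler \<phi> h = 0"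
  let ?R = "bilinear_relations (whole_space scale) (whole_space scale)"
  let ?E = "(\<lambda>z. Poly_Mapping.single z 1) ` A"
  have "comult_rep h \<in> formal.span (?R \<union> ?E)"
    unfolding formal_span_iff
  proof (intro allI impI)
    fix \<Phi> :: "'h \<times> 'h \<Rightarrow> 'k"
    assume \<Phi>: "\<forall>r\<in>?R \<union> ?E. formal_eval (*) \<Phi> r = 0"
    define \<phi> where "\<phi> x y = \<Phi> (x, y)" for x y
    have \<Phi>_eq: "\<Phi> = (\<lambda>(x, y). \<phi> x y)" by (auto simp: \<phi>_def)
    have "bilinear_form \<phi>"
      using \<Phi> by (simp add: \<Phi>_eq flip: bilinear_form_relations)
    moreover have "\<phi> x y = 0" if "(x, y) \<in> A" for x y
      using \<Phi>[rule_format, of "Poly_Mapping.single (x, y) 1"] that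
      by (simp add: \<Phi>_eq scalar_eval_simps)
    ultimately have "sweedler \<phi> h = 0" using * by blast
    thus "formal_eval (*) \<Phi> (comult_rep h) = 0" by (simp add: \<Phi>_eq sweedler_def)
  qed
  then obtain u p where "comult_rep h = u + p" "u \<in> square_relations" "Poly_Mapping.keys p \<subseteq> A"
    unfolding formal.span_Un formal_span_singles by blast
  thus "\<exists>p. Poly_Mapping.keys p \<subseteq> A \<and> \<Delta> h = p +o square_relations"
    unfolding comult_eq_comult_rep[of h] by (intro exI[of _ p]) (simp add: formal.coset_eq_iff)
qed

definition form_vanishing_on :: "'h set \<Rightarrow> ('h \<Rightarrow> 'h \<Rightarrow> 'k) \<Rightarrow> bool" where
  "form_vanishing_on A \<phi> \<longleftrightarrow> bilinear_form \<phi> \<and> (\<forall>x\<in>A. \<forall>y. \<phi> x y = 0)"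

lemma comult_in_tensor_image_iff:
  "\<Delta> h \<in> tensor_image (tensor_square scale) A UNIV \<longleftrightarrow>
     (\<forall>\<phi>. form_vanishing_on A \<phi> \<longrightarrow> sweedler \<phi> h = 0)"
proof -
  have "\<Delta> h \<in> tensor_image (tensor_square scale) A UNIV \<longleftrightarrow>
      (\<exists>p. Poly_Mapping.keys p \<subseteq> A \<times> UNIV \<and> \<Delta> h = p +o square_relations)"
    unfolding tensor_image_def vzero_square by blast
  thus ?thesis
    unfolding comult_supported_iff form_vanishing_on_def by (simp add: imp_conjL)
qed

lemma coideal_iff:
  "coideal scale \<Delta> \<epsilon> I \<longleftrightarrow> subspace I \<and>
     (\<forall>h\<in>I. \<forall>\<phi>. form_vanishing_on I \<phi> \<longrightarrow> (\<forall>x. \<forall>y\<in>I. \<phi> x y = 0) \<longrightarrow> sweedler \<phi> h = 0) \<and>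
     (\<forall>h\<in>I. \<epsilon> h = 0)"
proof -
  let ?E = "\<lambda>A :: ('h \<times> 'h) set. (\<lambda>z. Poly_Mapping.single z (1::'k)) ` A"
  let ?X = "tensor_image (tensor_square scale) I UNIV + tensor_image (tensor_square scale) UNIV I"
  have "X \<in> ?X \<longleftrightarrow> (\<exists>p. Poly_Mapping.keys p \<subseteq> I \<times> UNIV \<union> UNIV \<times> I \<and> X = p +o square_relations)" for X
  proof -
    have "X \<in> ?X \<longleftrightarrow> (\<exists>p q. Poly_Mapping.keys p \<subseteq> I \<times> UNIV \<and> Poly_Mapping.keys q \<subseteq> UNIV \<times> I \<and>
        X = (p + q) +o square_relations)"
    proof
      assume "X \<in> ?X"
      then obtain Y Z where "X = Y + Z" "Y \<in> tensor_image (tensor_square scale) I UNIV"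
          "Z \<in> tensor_image (tensor_square scale) UNIV I"
        by (rule set_plus_elim)
      moreover from this obtain p q where "Poly_Mapping.keys p \<subseteq> I \<times> UNIV" "Y = p +o square_relations"
          "Poly_Mapping.keys q \<subseteq> UNIV \<times> I" "Z = q +o square_relations"
        unfolding tensor_image_def vzero_square by blast
      ultimately show "\<exists>p q. Poly_Mapping.keys p \<subseteq> I \<times> UNIV \<and> Poly_Mapping.keys q \<subseteq> UNIV \<times> I \<and>
          X = (p + q) +o square_relations"
        by (intro exI[of _ p] exI[of _ q]) (simp add: formal.coset_add)
    next
      assume "\<exists>p q. Poly_Mapping.keys p \<subseteq> I \<times> UNIV \<and> Poly_Mapping.keys q \<subseteq> UNIV \<times> I \<and>
          X = (p + q) +o square_relations"
      then obtain p q where pq: "Poly_Mapping.keys p \<subseteq> I \<times> UNIV" "Poly_Mapping.keys q \<subseteq> UNIV \<times> I"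
          "X = (p + q) +o square_relations" by blast
      have "X = (p +o square_relations) + (q +o square_relations)"
        by (simp add: pq formal.coset_add)
      thus "X \<in> ?X" using pq(1,2) unfolding tensor_image_def vzero_square by blast
    qed
    also have "\<dots> \<longleftrightarrow> (\<exists>r\<in>formal.span (?E (I \<times> UNIV) \<union> ?E (UNIV \<times> I)). X = r +o square_relations)"
      unfolding formal.span_Un formal_span_singles by auto
    also have "?E (I \<times> UNIV) \<union> ?E (UNIV \<times> I) = ?E (I \<times> UNIV \<union> UNIV \<times> I)" by (simp add: image_Un)
    finally show ?thesis unfolding formal_span_singles by auto
  qed
  moreover have "(\<forall>(x, y)\<in>I \<times> UNIV \<union> UNIV \<times> I. \<phi> x y = 0) \<longleftrightarrow>
      (\<forall>x\<in>I. \<forall>y. \<phi> x y = 0) \<and> (\<forall>x. \<forall>y\<in>I. \<phi> x y = 0)" for \<phi> :: "'h \<Rightarrow> 'h \<Rightarrow> 'k"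
    by auto
  ultimately have "\<Delta> h \<in> ?X \<longleftrightarrow>
     (\<forall>\<phi>. form_vanishing_on I \<phi> \<longrightarrow> (\<forall>x. \<forall>y\<in>I. \<phi> x y = 0) \<longrightarrow> sweedler \<phi> h = 0)" for h
    by (simp only: comult_supported_iff form_vanishing_on_def imp_conjL)
  thus ?thesis unfolding coideal_def image_subset_iff by simp
qed

abbreviation quotient_relations :: "'h set \<Rightarrow> ('h set \<times> 'h \<Rightarrow>\<^sub>0 'k) set" where
  "quotient_relations I \<equiv> formal.span (bilinear_relations (quotient_space UNIV scale I) (whole_space scale))"

text \<open>
  If \<open>\<phi>\<close> vanishes on \<open>I \<times> H\<close>, then the choice of \<open>x\<close> in its coset is immaterial, and this is the
  functional on \<open>H/I \<otimes> H\<close> that \<open>\<phi>\<close> induces.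
\<close>

definition quotient_eval :: "('h \<Rightarrow> 'h \<Rightarrow> 'k) \<Rightarrow> ('h set \<times> 'h \<Rightarrow>\<^sub>0 'k) \<Rightarrow> 'k" where
  "quotient_eval \<phi> = formal_eval (*) (\<lambda>(X, y). \<phi> (SOME x. x \<in> X) y)"

lemma form_representative:
  assumes "subspace I" "form_vanishing_on I \<phi>"
  shows "\<phi> (SOME x. x \<in> v +o I) y = \<phi> v y"
proof -
  have "\<phi> ((SOME x. x \<in> v +o I) - v) y = 0"
    using coset_representative[OF assms(1), of v] assms(2) by (auto simp: form_vanishing_on_def)
  thus ?thesis using assms(2) by (simp add: form_vanishing_on_def bilinear_formD)
qed

text \<open>
  Bilinear forms on \<open>H/I \<times> H\<close> are the bilinear forms on \<open>H \<times> H\<close> that vanish on \<open>I \<times> H\<close>; the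
  condition on the keys is there because a form on \<open>H/I\<close> says nothing about sets that are not
  cosets of \<open>I\<close>.
\<close>

lemma quotient_coset_eq_iff:
  assumes I: "subspace I"
    and keys: "Poly_Mapping.keys p \<subseteq> range (\<lambda>x. x +o I) \<times> UNIV"
      "Poly_Mapping.keys q \<subseteq> range (\<lambda>x. x +o I) \<times> UNIV"
  shows "p +o quotient_relations I = q +o quotient_relations I \<longleftrightarrow>
     (\<forall>\<phi>. form_vanishing_on I \<phi> \<longrightarrow> quotient_eval \<phi> p = quotient_eval \<phi> q)"
proof (intro iffI allI impI)
  fix \<phi> assume "form_vanishing_on I \<phi>"
  moreover from this have "bilinear_form \<phi>" by (simp add: form_vanishing_on_def)
  ultimately have "\<forall>r\<in>bilinear_relations (quotient_space UNIV scale I) (whole_space scale).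
      formal_eval (*) (\<lambda>(X, y). \<phi> (SOME x. x \<in> X) y) r = 0"
    unfolding formal_eval_bilinear_relations
    by (auto simp: coset_add[OF I] coset_scale[OF I] form_representative[OF I] bilinear_formD)
  moreover assume "p +o quotient_relations I = q +o quotient_relations I"
  ultimately show "quotient_eval \<phi> p = quotient_eval \<phi> q"
    unfolding quotient_eval_def by (rule tensor_coset_eqD[rotated])
next
  assume *: "\<forall>\<phi>. form_vanishing_on I \<phi> \<longrightarrow> quotient_eval \<phi> p = quotient_eval \<phi> q"
  have "p - q \<in> quotient_relations I"
    unfolding formal_span_iff
  proof (intro allI impI)
    fix \<Phi> :: "'h set \<times> 'h \<Rightarrow> 'k"
    let ?R = "bilinear_relations (quotient_space UNIV scale I) (whole_space scale)"
    assume \<Phi>: "\<forall>r\<in>?R. formal_eval (*) \<Phi> r = 0"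
    define \<phi> where "\<phi> x y = \<Phi> (x +o I, y)" for x y
    have "\<Phi> = (\<lambda>(X, y). curry \<Phi> X y)" by auto
    with \<Phi> have rel: "\<forall>r\<in>?R. formal_eval (*) (\<lambda>(X, y). curry \<Phi> X y) r = 0" by simp
    have \<phi>: "bilinear_form \<phi>"
      using rel unfolding formal_eval_bilinear_relations bilinear_form_def
      by (simp add: \<phi>_def coset_add[OF I] coset_scale[OF I])
    moreover have "\<phi> x y = 0" if "x \<in> I" for x y
    proof -
      have "x +o I = 0 +o I" using I that by (subst coset_eq_iff) auto
      hence "\<phi> x y = \<phi> 0 y" by (simp add: \<phi>_def)
      with \<phi> show ?thesis by (simp add: bilinear_formD)
    qed
    ultimately have "form_vanishing_on I \<phi>" by (simp add: form_vanishing_on_def)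
    with * have "quotient_eval \<phi> p = quotient_eval \<phi> q" by blast
    moreover have "quotient_eval \<phi> r = formal_eval (*) \<Phi> r"
      if keys_r: "Poly_Mapping.keys r \<subseteq> range (\<lambda>x. x +o I) \<times> UNIV" for r
      unfolding quotient_eval_def
    proof (rule formal_eval_cong)
      fix z assume "z \<in> Poly_Mapping.keys r"
      then obtain v y where z: "z = (v +o I, y)" using keys_r by auto
      have "(SOME x. x \<in> v +o I) +o I = v +o I"
        using coset_representative[OF I] by (subst coset_eq_iff[OF I])
      thus "(case z of (X, y) \<Rightarrow> \<phi> (SOME x. x \<in> X) y) = \<Phi> z" by (simp add: z \<phi>_def)
    qed
    ultimately show "formal_eval (*) \<Phi> (p - q) = 0" using keys by (simp add: scalar_eval_simps)
  qed
  thus "p +o quotient_relations I = q +o quotient_relations I" by (simp add: formal.coset_eq_iff)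
qed

end

context bialgebra_over
begin

lemma mem_coinvariants_iff:
  assumes I: "subspace I"
  shows "h \<in> coinvariants scale \<Delta> (quotient_space UNIV scale I) \<longleftrightarrow>
     (\<forall>\<phi>. form_vanishing_on I \<phi> \<longrightarrow> sweedler \<phi> h = \<phi> 1 h)"
proof -
  define p where "p = formal_eval formal_scale
    (\<lambda>(x, y). Poly_Mapping.single (x +o I, y) (1::'k)) (SOME p. p \<in> \<Delta> h)"
  let ?q = "Poly_Mapping.single (1 +o I, h) (1::'k)"
  have lift: "tensor_lift (tensor (quotient_space UNIV scale I) (whole_space scale))
      (\<lambda>x y. pure_tensor (tensor (quotient_space UNIV scale I) (whole_space scale))
        (quotient_map (quotient_space UNIV scale I) x) y) (\<Delta> h) = p +o quotient_relations I"
    unfolding p_def by (rule tensor_lift_tensor) (simp add: pure_tensor_tensor quotient_map_def)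
  have "h \<in> coinvariants scale \<Delta> (quotient_space UNIV scale I) \<longleftrightarrow>
      p +o quotient_relations I = ?q +o quotient_relations I"
    unfolding coinvariants_def Let_def mem_Collect_eq lift
    by (simp add: pure_tensor_tensor quotient_map_def)
  also have "\<dots> \<longleftrightarrow> (\<forall>\<phi>. form_vanishing_on I \<phi> \<longrightarrow> quotient_eval \<phi> p = quotient_eval \<phi> ?q)"
    by (rule quotient_coset_eq_iff[OF I])
      (auto simp: p_def split_def intro!: keys_formal_eval_subset)
  also have "\<dots> \<longleftrightarrow> (\<forall>\<phi>. form_vanishing_on I \<phi> \<longrightarrow> sweedler \<phi> h = \<phi> 1 h)"
  proof -
    have "quotient_eval \<phi> p = sweedler \<phi> h" "quotient_eval \<phi> ?q = \<phi> 1 h"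
      if \<phi>: "form_vanishing_on I \<phi>" for \<phi>
    proof -
      have "quotient_eval \<phi> p = square_eval \<phi> (\<Delta> h)"
        by (simp add: quotient_eval_def p_def formal_eval_eval scalars_vector_space split_def
            scalar_eval_simps form_representative[OF I \<phi>] square_eval_def)
      thus "quotient_eval \<phi> p = sweedler \<phi> h"
        using \<phi> by (simp add: square_eval_comult form_vanishing_on_def)
      show "quotient_eval \<phi> ?q = \<phi> 1 h"
        by (simp add: quotient_eval_def scalar_eval_simps form_representative[OF I \<phi>])
    qed
    thus ?thesis by simp
  qed
  finally show ?thesis .
qed

section \<open>The canonical map in terms of bilinear forms\<close>

definition balanced_form :: "'h set \<Rightarrow> ('h \<Rightarrow> 'h \<Rightarrow> 'k) \<Rightarrow> bool" where
  "balanced_form K \<phi> \<longleftrightarrow> bilinear_form \<phi> \<and> (\<forall>x y. \<forall>a\<in>K. \<phi> (x * a) y = \<phi> x (a * y))"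

definition balanced_relations :: "'h set \<Rightarrow> ('h \<times> 'h \<Rightarrow>\<^sub>0 'k) set" where
  "balanced_relations K = formal.span (bilinear_relations (whole_space scale) (whole_space scale) \<union>
      {Poly_Mapping.single (x * a, y) 1 - Poly_Mapping.single (x, a * y) 1 | x a y. a \<in> K})"

lemma mem_balanced_relations_iff:
  "p \<in> balanced_relations K \<longleftrightarrow>
     (\<forall>\<phi>. balanced_form K \<phi> \<longrightarrow> formal_eval (*) (\<lambda>(x, y). \<phi> x y) p = 0)"
proof -
  let ?B = "{Poly_Mapping.single (x * a, y) 1 - Poly_Mapping.single (x, a * y) (1::'k) | x a y. a \<in> K}"
  let ?R = "bilinear_relations (whole_space scale) (whole_space scale) \<union> ?B"
  have balanced: "(\<forall>r\<in>?R. formal_eval (*) (\<lambda>(x, y). \<phi> x y) r = 0) \<longleftrightarrow> balanced_form K \<phi>" for \<phi>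
  proof -
    have "(\<forall>r\<in>?B. formal_eval (*) (\<lambda>(x, y). \<phi> x y) r = 0) \<longleftrightarrow> (\<forall>x y. \<forall>a\<in>K. \<phi> (x * a) y = \<phi> x (a * y))"
      by (fastforce simp: scalar_eval_simps)
    thus ?thesis by (simp only: ball_Un bilinear_form_relations balanced_form_def)
  qed
  have "p \<in> balanced_relations K \<longleftrightarrow>
    (\<forall>\<phi>. (\<forall>r\<in>?R. formal_eval (*) (\<lambda>(x, y). \<phi> x y) r = 0) \<longrightarrow> formal_eval (*) (\<lambda>(x, y). \<phi> x y) p = 0)"
  proof -
    have "(\<forall>\<Phi> :: 'h \<times> 'h \<Rightarrow> 'k. P \<Phi>) \<longleftrightarrow> (\<forall>\<phi>. P (\<lambda>(x, y). \<phi> x y))" for P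
      by (metis case_prod_curry)
    thus ?thesis unfolding balanced_relations_def formal_span_iff by simp
  qed
  thus ?thesis by (simp only: balanced)
qed

text \<open>
  \<open>\<phi> \<circ> \<beta>\<close>, where \<open>\<beta>\<close> sends \<open>x \<otimes> y\<close> to \<open>x\<^sub>1 \<otimes> x\<^sub>2 y\<close>.
\<close>

definition galois_eval :: "('h \<Rightarrow> 'h \<Rightarrow> 'k) \<Rightarrow> ('h \<times> 'h \<Rightarrow>\<^sub>0 'k) \<Rightarrow> 'k" where
  "galois_eval \<phi> = formal_eval (*) (\<lambda>(x, y). sweedler (\<lambda>a b. \<phi> a (b * y)) x)"

text \<open>
  A formal sum that represents the image of a formal sum under the canonical map.
\<close>

definition galois_formal :: "'h set \<Rightarrow> ('h \<times> 'h \<Rightarrow>\<^sub>0 'k) \<Rightarrow> ('h set \<times> 'h \<Rightarrow>\<^sub>0 'k)" where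
  "galois_formal I = formal_eval formal_scale (\<lambda>(x, y). formal_eval formal_scale
      (\<lambda>(a, b). Poly_Mapping.single (a +o I, b * y) 1) (SOME p. p \<in> \<Delta> x))"

lemma canonical_map_eq:
  "canonical_map scale \<Delta> (quotient_space UNIV scale I) X =
     galois_formal I (SOME p. p \<in> X) +o quotient_relations I"
  unfolding canonical_map_def Let_def galois_formal_def
  by (rule tensor_lift_tensor
      tensor_lift_tensor[where \<beta> = "\<lambda>a b. Poly_Mapping.single (a +o I, b * y) 1" for y])+
    (simp add: pure_tensor_tensor quotient_map_def)

lemma keys_galois_formal: "Poly_Mapping.keys (galois_formal I p) \<subseteq> range (\<lambda>x. x +o I) \<times> UNIV"
  by (auto simp: galois_formal_def split_def intro!: keys_formal_eval_subset)

lemma quotient_eval_galois_formal: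
  assumes "subspace I" "form_vanishing_on I \<phi>"
  shows "quotient_eval \<phi> (galois_formal I p) = galois_eval \<phi> p"
proof -
  have \<phi>: "bilinear_form \<phi>" using assms by (simp add: form_vanishing_on_def)
  have "quotient_eval \<phi> (galois_formal I p) =
      formal_eval (*) (\<lambda>(x, y). square_eval (\<lambda>a b. \<phi> a (b * y)) (\<Delta> x)) p"
    by (simp add: quotient_eval_def galois_formal_def formal_eval_eval scalars_vector_space split_def
            scalar_eval_simps form_representative[OF assms] square_eval_def)
  also have "\<dots> = galois_eval \<phi> p"
    by (simp add: galois_eval_def square_eval_comult bilinear_form_def bilinear_formD[OF \<phi>] mult_simps)
  finally show ?thesis .
qed

end

section \<open>Right coideal subalgebras and the left ideals they generate\<close>

context hopf_algebra
begin

text \<open>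
  By uniqueness of convolution inverses: both \<open>(x, y) \<mapsto> S(xy)\<close> and
  \<open>(x, y) \<mapsto> S(y) S(x)\<close> are inverse to \<open>(x, y) \<mapsto> xy\<close>. The proof evaluates
  \<open>S(x\<^sub>1 y\<^sub>1) x\<^sub>2 y\<^sub>2 S(y\<^sub>3) S(x\<^sub>3)\<close> by contracting the factors with indices 2 and 3, or 1 and 2.
\<close>

lemma antipode_mult:
  assumes "linear_form f"
  shows "f (S (x * y)) = f (S y * S x)"
proof -
  from assms have f: "f (x + y) = f x + f y" "f (scale c x) = c * f x" for c x y
    by (simp_all add: linear_form_iff)
  note bilinear = bilinear_form_def linear_form_iff mult_simps f algebra_simps
  define g where "g x1 x2 x3 y1 y2 y3 = f (S (x1 * y1) * x2 * y2 * S y3 * S x3)" for x1 x2 x3 y1 y2 y3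
  define A where "A x1 x2 x3 = sweedler (\<lambda>y1 t. sweedler (\<lambda>y2 y3. g x1 x2 x3 y1 y2 y3) t) y" for x1 x2 x3
  have A_right: "A x1 x2 x3 = f (S (x1 * y) * x2 * S x3)" for x1 x2 x3
  proof -
    have "sweedler (\<lambda>y2 y3. g x1 x2 x3 y1 y2 y3) t = f (S (x1 * y1) * x2 * S x3) * \<epsilon> t" for y1 t
      using sweedler_antipode_right[of "\<lambda>z. f (S (x1 * y1) * x2 * z * S x3)" t]
      by (simp add: g_def bilinear)
    hence "A x1 x2 x3 = sweedler (\<lambda>y1 t. f (S (x1 * y1) * x2 * S x3) * \<epsilon> t) y"
      by (simp add: A_def)
    also have "\<dots> = f (S (x1 * y) * x2 * S x3)"
      by (rule sweedler_counit_right) (simp add: bilinear)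
    finally show ?thesis .
  qed
  have A_left: "A x1 x2 x3 = sweedler (\<lambda>t y3. sweedler (\<lambda>y1 y2. g x1 x2 x3 y1 y2 y3) t) y" for x1 x2 x3
    unfolding A_def by (rule sweedler_coassoc[symmetric]) (simp_all add: g_def bilinear)
  \<comment> \<open>Contract the indices 2 and 3, then regroup so that the indices 1 and 2 meet.\<close>
  have "f (S (x * y)) = sweedler (\<lambda>x1 t. f (S (x1 * y)) * \<epsilon> t) x"
    by (rule sweedler_counit_right[symmetric]) (simp add: bilinear)
  also have "\<dots> = sweedler (\<lambda>x1 t. sweedler (\<lambda>x2 x3. A x1 x2 x3) t) x"
    using sweedler_antipode_right[of "\<lambda>z. f (S (x1 * y) * z)" for x1]
    by (simp add: A_right bilinear)
  also have "\<dots> = sweedler (\<lambda>t x3. sweedler (\<lambda>x1 x2. A x1 x2 x3) t) x"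
    by (rule sweedler_coassoc[symmetric]) (simp_all add: A_right bilinear)
  also have "\<dots> = sweedler (\<lambda>t x3. sweedler (\<lambda>u y3.
      sweedler (\<lambda>x1 x2. sweedler (\<lambda>y1 y2. g x1 x2 x3 y1 y2 y3) u) t) y) x"
    unfolding A_left by (subst sweedler_swap) simp
  also have "\<dots> = sweedler (\<lambda>t x3. sweedler (\<lambda>u y3. \<epsilon> t * (\<epsilon> u * f (S y3 * S x3))) y) x"
  proof -
    have "sweedler (\<lambda>x1 x2. sweedler (\<lambda>y1 y2. g x1 x2 x3 y1 y2 y3) u) t = \<epsilon> t * (\<epsilon> u * f (S y3 * S x3))"
      for t u x3 y3
    proof -
      have "sweedler (\<lambda>x1 x2. sweedler (\<lambda>y1 y2. g x1 x2 x3 y1 y2 y3) u) t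
          = sweedler (\<lambda>a b. f (S a * b * S y3 * S x3)) (t * u)"
        by (subst sweedler_mult) (simp_all add: g_def bilinear)
      also have "\<dots> = \<epsilon> (t * u) * f (S y3 * S x3)"
        using sweedler_antipode_left[of "\<lambda>z. f (z * S y3 * S x3)" "t * u"] by (simp add: bilinear)
      finally show ?thesis by (simp add: counit_mult)
    qed
    thus ?thesis by simp
  qed
  also have "\<dots> = sweedler (\<lambda>t x3. \<epsilon> t * f (S y * S x3)) x"
    using sweedler_counit_left[of "\<lambda>z. f (S z * S x3)" y for x3] by (simp add: bilinear)
  also have "\<dots> = f (S y * S x)"
    by (rule sweedler_counit_left) (simp add: bilinear)
  finally show ?thesis .
qed

lemma right_coideal_subalgebra_iff:
  "right_coideal_subalgebra scale \<Delta> K \<longleftrightarrow>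
     subalgebra scale K \<and> (\<forall>h\<in>K. \<forall>\<phi>. form_vanishing_on K \<phi> \<longrightarrow> sweedler \<phi> h = 0)"
  by (simp add: right_coideal_subalgebra_def image_subset_iff comult_in_tensor_image_iff)

text \<open>The left ideal \<open>HK\<^sup>+\<close>.\<close>

definition left_ideal_plus :: "'h set \<Rightarrow> 'h set" where
  "left_ideal_plus K = span {h * x | h x. x \<in> K \<and> \<epsilon> x = 0}"

lemma subspace_left_ideal_plus: "subspace (left_ideal_plus K)"
  by (simp add: left_ideal_plus_def)

lemma left_ideal_plus_base: "x \<in> K \<Longrightarrow> \<epsilon> x = 0 \<Longrightarrow> h * x \<in> left_ideal_plus K"
  unfolding left_ideal_plus_def by (rule span_base) auto

lemma left_ideal_plus_left_ideal:
  assumes "x \<in> left_ideal_plus K"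
  shows "h * x \<in> left_ideal_plus K"
  using assms unfolding left_ideal_plus_def
proof (induction rule: span_induct_alt)
  case base
  show ?case by (simp add: span_zero)
next
  case (step c x y)
  then obtain g k where "x = g * k" "k \<in> K" "\<epsilon> k = 0" by auto
  hence "h * x \<in> span {h * x |h x. x \<in> K \<and> \<epsilon> x = 0}"
    using left_ideal_plus_base[of k K "h * g"] by (simp add: left_ideal_plus_def mult.assoc)
  with step show ?case by (simp add: mult_simps span_add span_scale)
qed

text \<open>
  Modulo \<open>HK\<^sup>+\<close>, an element \<open>x\<close> of \<open>K\<close> on the right acts as the scalar \<open>\<epsilon>(x)\<close>, because
  \<open>x - \<epsilon>(x) 1 \<in> K\<^sup>+\<close>.
\<close>

lemma linear_form_left_ideal_plus:
  assumes "subalgebra scale K" "x \<in> K" "linear_form f" "\<forall>z\<in>left_ideal_plus K. f z = 0"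
  shows "f (h * x) = \<epsilon> x * f h"
proof -
  have "x - scale (\<epsilon> x) 1 \<in> K"
    using assms(1,2) by (auto simp: subalgebra_def intro: subspace_diff subspace_scale)
  hence "h * (x - scale (\<epsilon> x) 1) \<in> left_ideal_plus K"
    by (rule left_ideal_plus_base) (simp add: counit_one)
  hence "f (h * (x - scale (\<epsilon> x) 1)) = 0" using assms(4) by blast
  moreover have "h * x = h * (x - scale (\<epsilon> x) 1) + scale (\<epsilon> x) h"
    by (simp add: algebra_simps scale_mult_right[symmetric])
  ultimately show ?thesis using assms(3) by (simp add: linear_form_iff)
qed

text \<open>
  For \<open>k \<in> K\<close> the factor \<open>k\<^sub>1\<close> may be taken in \<open>K\<close>.
\<close>

lemma sweedler_right_coideal_cong:
  assumes "right_coideal_subalgebra scale \<Delta> K" "k \<in> K" "bilinear_form \<phi>" "bilinear_form \<psi>"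
    and "\<And>x y. x \<in> K \<Longrightarrow> \<phi> x y = \<psi> x y"
  shows "sweedler \<phi> k = sweedler \<psi> k"
proof -
  have "form_vanishing_on K (\<lambda>x y. \<phi> x y - \<psi> x y)"
    using assms(3-5) by (simp add: form_vanishing_on_def bilinear_form_def algebra_simps)
  hence "sweedler (\<lambda>x y. \<phi> x y - \<psi> x y) k = 0"
    using assms(1,2) unfolding right_coideal_subalgebra_iff by blast
  thus ?thesis by simp
qed

lemma sweedler_right_coideal:
  assumes "right_coideal_subalgebra scale \<Delta> K" "k \<in> K" "bilinear_form \<phi>"
    and "\<And>x y. x \<in> K \<Longrightarrow> \<phi> x y = \<epsilon> x * \<phi> 1 y"
  shows "sweedler \<phi> k = \<phi> 1 k"
proof -
  have "sweedler \<phi> k = sweedler (\<lambda>x y. \<epsilon> x * \<phi> 1 y) k"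
    using assms by (intro sweedler_right_coideal_cong[OF assms(1,2)])
      (auto simp: bilinear_form_def algebra_simps)
  also have "\<dots> = \<phi> 1 k"
    by (rule sweedler_counit_left) (rule linear_form_bilinear[OF assms(3)])
  finally show ?thesis .
qed

text \<open>
  For \<open>k \<in> K\<^sup>+\<close>, replacing \<open>k\<^sub>1 \<in> K\<close> by \<open>\<epsilon>(k\<^sub>1)\<close> changes \<open>\<Delta>(gk) = g\<^sub>1 k\<^sub>1 \<otimes> g\<^sub>2 k\<^sub>2\<close> by an element of
  \<open>HK\<^sup>+ \<otimes> H\<close>, and leaves \<open>g\<^sub>1 \<otimes> g\<^sub>2 k \<in> H \<otimes> HK\<^sup>+\<close>.
\<close>

lemma left_ideal_coideal_left_ideal_plus:
  assumes K: "right_coideal_subalgebra scale \<Delta> K"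
  shows "left_ideal_coideal scale \<Delta> \<epsilon> (left_ideal_plus K)"
proof -
  have sub: "subalgebra scale K" using K by (simp add: right_coideal_subalgebra_def)
  have "sweedler \<phi> h = 0"
    if h: "h \<in> left_ideal_plus K" and \<phi>: "form_vanishing_on (left_ideal_plus K) \<phi>"
      and right: "\<forall>x. \<forall>y\<in>left_ideal_plus K. \<phi> x y = 0" for h \<phi>
    using h unfolding left_ideal_plus_def
  proof (induction rule: span_induct_alt)
    case (step c x y)
    then obtain g k where x: "x = g * k" "k \<in> K" "\<epsilon> k = 0" by auto
    have bil: "bilinear_form \<phi>" and left: "\<forall>x\<in>left_ideal_plus K. \<forall>y. \<phi> x y = 0"
      using \<phi> by (auto simp: form_vanishing_on_def)
    have "sweedler (\<lambda>c d. \<phi> (a * c) (b * d)) k = \<phi> (a * 1) (b * k)" for a b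
    proof (rule sweedler_right_coideal[OF K \<open>k \<in> K\<close>])
      show "bilinear_form (\<lambda>c d. \<phi> (a * c) (b * d))"
        by (simp add: bilinear_form_def mult_simps bilinear_formD[OF bil])
      show "\<phi> (a * c) (b * d) = \<epsilon> c * \<phi> (a * 1) (b * d)" if "c \<in> K" for c d
        using linear_form_left_ideal_plus[OF sub that linear_form_bilinear(1)[OF bil]] left by simp
    qed
    hence "sweedler \<phi> x = sweedler (\<lambda>a b. \<phi> a (b * k)) g"
      by (simp add: x sweedler_mult[OF bil])
    also have "\<dots> = 0" using right left_ideal_plus_base[OF x(2,3)] by simp
    finally show ?case using step by simp
  qed simp
  moreover have "\<epsilon> h = 0" if "h \<in> left_ideal_plus K" for h
    using that unfolding left_ideal_plus_def
    by (induction rule: span_induct_alt) (auto simp: counit_mult)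
  ultimately show ?thesis
    unfolding left_ideal_coideal_def coideal_iff
    using subspace_left_ideal_plus left_ideal_plus_left_ideal by blast
qed

section \<open>Coinvariants form a right coideal subalgebra\<close>

abbreviation coinv :: "'h set \<Rightarrow> 'h set" where
  "coinv I \<equiv> coinvariants scale \<Delta> (quotient_space UNIV scale I)"

text \<open>
  Since \<open>k\<^sub>1 \<in> K\<close>, modulo \<open>HK\<^sup>+\<close> one has \<open>k\<^sub>1 \<otimes> k\<^sub>2 = \<epsilon>(k\<^sub>1) 1 \<otimes> k\<^sub>2 = 1 \<otimes> k\<close>.
\<close>

lemma subset_coinv_left_ideal_plus:
  assumes K: "right_coideal_subalgebra scale \<Delta> K"
  shows "K \<subseteq> coinv (left_ideal_plus K)"
proof
  fix k assume k: "k \<in> K"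
  have sub: "subalgebra scale K" using K by (simp add: right_coideal_subalgebra_def)
  have "sweedler \<phi> k = \<phi> 1 k" if \<phi>: "form_vanishing_on (left_ideal_plus K) \<phi>" for \<phi>
  proof (rule sweedler_right_coideal[OF K k])
    show bil: "bilinear_form \<phi>" using \<phi> by (simp add: form_vanishing_on_def)
    show "\<phi> x y = \<epsilon> x * \<phi> 1 y" if "x \<in> K" for x y
      using linear_form_left_ideal_plus[OF sub that linear_form_bilinear(1)[OF bil], of y 1] \<phi>
      by (simp add: form_vanishing_on_def)
  qed
  thus "k \<in> coinv (left_ideal_plus K)"
    by (simp add: mem_coinvariants_iff subspace_left_ideal_plus)
qed

text \<open>
  Applying \<open>\<epsilon>\<close> to the second factor of \<open>\<pi>(x\<^sub>1) \<otimes> x\<^sub>2 = \<pi>(1) \<otimes> x\<close> gives \<open>\<pi>(x) = \<epsilon>(x) \<pi>(1)\<close>.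
\<close>

lemma left_ideal_plus_coinv_subset:
  assumes I: "subspace I" "\<And>h x. x \<in> I \<Longrightarrow> h * x \<in> I"
  shows "left_ideal_plus (coinv I) \<subseteq> I"
proof -
  have "x \<in> I" if x: "x \<in> coinv I" "\<epsilon> x = 0" for x
  proof (rule ccontr)
    assume "x \<notin> I"
    then obtain f where f: "linear_form f" "\<forall>v\<in>I. f v = 0" "f x \<noteq> 0"
      using separating_functional[OF I(1)] by blast
    have "form_vanishing_on I (\<lambda>a b. f a * \<epsilon> b)"
      using f by (simp add: form_vanishing_on_def bilinear_form_def linear_form_iff algebra_simps)
    hence "sweedler (\<lambda>a b. f a * \<epsilon> b) x = f 1 * \<epsilon> x"
      using x(1) mem_coinvariants_iff[OF I(1)] by blast
    hence "f x = 0" by (simp only: sweedler_counit_right[OF f(1)] x(2)) simp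
    with f(3) show False by simp
  qed
  thus ?thesis
    unfolding left_ideal_plus_def by (intro span_minimal) (auto intro: I)
qed

text \<open>
  As \<open>I\<close> is a left ideal, \<open>\<pi>(g\<^sub>1 h\<^sub>1) \<otimes> g\<^sub>2 h\<^sub>2 = g\<^sub>1 \<pi>(h\<^sub>1) \<otimes> g\<^sub>2 h\<^sub>2\<close> is defined; contracting first \<open>h\<close>
  and then \<open>g\<close> gives \<open>\<pi>(1) \<otimes> gh\<close>.
\<close>

lemma subalgebra_coinv:
  assumes I: "subspace I" "\<And>h x. x \<in> I \<Longrightarrow> h * x \<in> I"
  shows "subalgebra scale (coinv I)"
proof -
  have mult: "sweedler \<phi> (g * h) = \<phi> 1 (g * h)"
    if gh: "g \<in> coinv I" "h \<in> coinv I" and \<phi>: "form_vanishing_on I \<phi>" for g h \<phi>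
  proof -
    have bil: "bilinear_form \<phi>" using \<phi> by (simp add: form_vanishing_on_def)
    have "form_vanishing_on I (\<lambda>c d. \<phi> (a * c) (b * d))" for a b
      using \<phi> I(2) by (simp add: form_vanishing_on_def bilinear_form_def mult_simps)
    hence inner: "sweedler (\<lambda>c d. \<phi> (a * c) (b * d)) h = \<phi> a (b * h)" for a b
      using gh(2) unfolding mem_coinvariants_iff[OF I(1)] by fastforce
    have "form_vanishing_on I (\<lambda>a b. \<phi> a (b * h))"
      using \<phi> by (simp add: form_vanishing_on_def bilinear_form_def mult_simps)
    hence "sweedler (\<lambda>a b. \<phi> a (b * h)) g = \<phi> 1 (g * h)"
      using gh(1) unfolding mem_coinvariants_iff[OF I(1)] by fastforce
    thus ?thesis by (simp add: sweedler_mult[OF bil] inner)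
  qed
  note mem = mem_coinvariants_iff[OF I(1)]
  have "0 \<in> coinv I" "1 \<in> coinv I"
    by (simp_all add: mem form_vanishing_on_def bilinear_formD sweedler_one)
  moreover have "g + h \<in> coinv I" if "g \<in> coinv I" "h \<in> coinv I" for g h
    using that by (simp add: mem form_vanishing_on_def bilinear_formD)
  moreover have "scale c h \<in> coinv I" if "h \<in> coinv I" for c h
    using that by (simp add: mem form_vanishing_on_def bilinear_formD)
  moreover have "g * h \<in> coinv I" if "g \<in> coinv I" "h \<in> coinv I" for g h
    using mult[OF that] by (simp add: mem)
  ultimately show ?thesis
    by (simp add: subalgebra_def subspace_def)
qed

text \<open>
  Write \<open>\<Delta> h = \<Sum> X\<^sub>b \<otimes> b\<close> with \<open>b\<close> in a basis of \<open>H\<close>. By coassociativity the element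
  \<open>\<Sum> (\<pi>(X\<^sub>b\<^sub>1) \<otimes> X\<^sub>b\<^sub>2 - \<pi>(1) \<otimes> X\<^sub>b) \<otimes> b\<close> is \<open>(\<pi> \<otimes> \<Delta>)\<close> applied to \<open>h\<^sub>1 \<otimes> h\<^sub>2\<close>, minus \<open>\<pi>(1) \<otimes> \<Delta> h\<close>,
  hence zero as \<open>h\<close> is coinvariant. Because the \<open>b\<close> are independent, each \<open>X\<^sub>b\<close> is coinvariant.
\<close>

lemma right_coideal_coinv:
  assumes I: "subspace I" and h: "h \<in> coinv I" and \<phi>: "form_vanishing_on (coinv I) \<phi>"
  shows "sweedler \<phi> h = 0"
proof -
  note h_coinv = h[unfolded mem_coinvariants_iff[OF I], rule_format]
  obtain B where B: "independent B" "UNIV \<subseteq> span B"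
    by (rule maximal_independent_subset[of UNIV])
  hence in_span: "y \<in> span B" for y by auto
  define coord where "coord b y = representation B y b" for b y
  have coord: "coord b (y + z) = coord b y + coord b z" "coord b (scale c y) = c * coord b y" for b c y z
    using B in_span by (simp_all add: coord_def representation_add representation_scale)
  define X where "X b = formal_eval scale (\<lambda>(x, y). scale (coord b y) x) (comult_rep h)" for b
  have form_X: "f (X b) = sweedler (\<lambda>x y. f x * coord b y) h" if "linear_form f" for f b
    using linear_formal_eval_commute[OF that, of "\<lambda>(x, y). scale (coord b y) x"] that
    by (simp add: X_def sweedler_def split_def linear_form_iff mult.commute)
  have "X b \<in> coinv I" for b
    unfolding mem_coinvariants_iff[OF I]
  proof (intro allI impI)
    fix \<psi> assume \<psi>: "form_vanishing_on I \<psi>"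
    hence bil: "bilinear_form \<psi>" by (simp add: form_vanishing_on_def)
    note simps = bilinear_form_def bilinear_formD[OF bil] coord algebra_simps
    have "sweedler \<psi> (X b) = sweedler (\<lambda>x y. sweedler (\<lambda>a c. \<psi> a c * coord b y) x) h"
      by (subst form_X) (simp_all add: linear_form_iff)
    also have "\<dots> = sweedler (\<lambda>x y. sweedler (\<lambda>a c. \<psi> x a * coord b c) y) h"
      by (rule sweedler_coassoc) (simp_all add: simps)
    also have "\<dots> = sweedler (\<lambda>a c. \<psi> 1 a * coord b c) h"
      by (rule h_coinv) (use \<psi> in \<open>simp add: form_vanishing_on_def simps\<close>)
    also have "\<dots> = \<psi> 1 (X b)"
      by (rule form_X[symmetric]) (rule linear_form_bilinear[OF bil])
    finally show "sweedler \<psi> (X b) = \<psi> 1 (X b)" .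
  qed
  hence zero: "\<phi> (X b) b = 0" for b using \<phi> by (simp add: form_vanishing_on_def)
  have bil: "bilinear_form \<phi>" using \<phi> by (simp add: form_vanishing_on_def)
  define P where "P = Poly_Mapping.keys (comult_rep h)"
  \<comment> \<open>The basis may be infinite; only the vectors occurring in some second factor of \<open>\<Delta> h\<close> matter.\<close>
  define F where "F = (\<Union>(x, y)\<in>P. {b. coord b y \<noteq> 0})"
  have "finite F"
    unfolding F_def P_def coord_def by (auto simp: finite_representation)
  have expand: "\<phi> x y = (\<Sum>b\<in>F. \<phi> x b * coord b y)" if "(x, y) \<in> P" for x y
  proof -
    interpret \<phi>: Vector_Spaces.linear scale "(*)" "\<phi> x" by (rule linear_form_bilinear(2)[OF bil])
    have "y = (\<Sum>b | coord b y \<noteq> 0. scale (coord b y) b)"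
      using sum_nonzero_representation_eq[OF B(1) in_span, of y] by (simp add: coord_def)
    also have "\<dots> = (\<Sum>b\<in>F. scale (coord b y) b)"
      by (rule sum.mono_neutral_left) (use \<open>finite F\<close> that in \<open>auto simp: F_def\<close>)
    finally have y: "y = (\<Sum>b\<in>F. scale (coord b y) b)" .
    show ?thesis by (subst y) (simp add: \<phi>.sum \<phi>.scale mult.commute)
  qed
  have "sweedler \<phi> h = (\<Sum>(x, y)\<in>P. \<Sum>b\<in>F. Poly_Mapping.lookup (comult_rep h) (x, y) * (\<phi> x b * coord b y))"
    unfolding sweedler_def formal_eval_def P_def[symmetric]
    by (rule sum.cong) (auto simp: expand sum_distrib_left)
  also have "\<dots> = (\<Sum>b\<in>F. sweedler (\<lambda>x y. \<phi> x b * coord b y) h)"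
    by (simp add: sweedler_def formal_eval_def P_def split_def sum.swap[of _ F])
  also have "\<dots> = (\<Sum>b\<in>F. \<phi> (X b) b)"
    using form_X[OF linear_form_bilinear(1)[OF bil]] by simp
  finally show ?thesis by (simp add: zero)
qed

lemma right_coideal_subalgebra_coinv:
  assumes "subspace I" "\<And>h x. x \<in> I \<Longrightarrow> h * x \<in> I"
  shows "right_coideal_subalgebra scale \<Delta> (coinv I)"
  unfolding right_coideal_subalgebra_iff
  using subalgebra_coinv[OF assms] right_coideal_coinv[OF assms(1)] by blast

section \<open>The kernel of the canonical map\<close>

text \<open>
  The formal sums that the canonical map of \<open>H/I\<close> sends to zero.
\<close>

definition galois_kernel :: "'h set \<Rightarrow> ('h \<times> 'h \<Rightarrow>\<^sub>0 'k) set" where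
  "galois_kernel I = {p. \<forall>\<phi>. form_vanishing_on I \<phi> \<longrightarrow> galois_eval \<phi> p = 0}"

text \<open>
  The canonical map is well defined: for coinvariant \<open>a\<close>,
  \<open>\<pi>(x\<^sub>1 a\<^sub>1) \<otimes> x\<^sub>2 a\<^sub>2 y = \<pi>(x\<^sub>1) \<otimes> x\<^sub>2 a y\<close>.
\<close>

lemma balanced_relations_subset_galois_kernel:
  assumes I: "subspace I" "\<And>h x. x \<in> I \<Longrightarrow> h * x \<in> I"
  shows "balanced_relations (coinv I) \<subseteq> galois_kernel I"
proof
  fix p assume p: "p \<in> balanced_relations (coinv I)"
  have "galois_eval \<phi> p = 0" if \<phi>: "form_vanishing_on I \<phi>" for \<phi>
  proof -
    have bil: "bilinear_form \<phi>" using \<phi> by (simp add: form_vanishing_on_def)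
    note simps = bilinear_form_def bilinear_formD[OF bil] mult_simps
    have "sweedler (\<lambda>b c. \<phi> b (c * y)) (x * a) = sweedler (\<lambda>b c. \<phi> b (c * (a * y))) x"
      if a: "a \<in> coinv I" for x a y
    proof -
      have "form_vanishing_on I (\<lambda>d e. \<phi> (b * d) (c * e * y))" for b c
        using \<phi> I(2) by (simp add: form_vanishing_on_def simps)
      hence "sweedler (\<lambda>d e. \<phi> (b * d) (c * e * y)) a = \<phi> b (c * a * y)" for b c
        using a unfolding mem_coinvariants_iff[OF I(1)] by fastforce
      thus ?thesis
        by (subst sweedler_mult) (simp_all add: simps mult.assoc)
    qed
    hence "balanced_form (coinv I) (\<lambda>x y. sweedler (\<lambda>b c. \<phi> b (c * y)) x)"
      by (simp add: balanced_form_def simps)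
    thus ?thesis
      using p unfolding mem_balanced_relations_iff galois_eval_def by blast
  qed
  thus "p \<in> galois_kernel I" by (simp add: galois_kernel_def)
qed

text \<open>
  The next two lemmas say that \<open>x \<otimes> y \<mapsto> x\<^sub>1 \<otimes> x\<^sub>2 y\<close> and \<open>x \<otimes> y \<mapsto> x\<^sub>1 \<otimes> S(x\<^sub>2) y\<close> are inverse to each
  other.
\<close>

lemma sweedler_antipode_cancel_right:
  assumes "bilinear_form \<psi>"
  shows "sweedler (\<lambda>a b. sweedler (\<lambda>c d. \<psi> c (S d * (b * y))) a) x = \<psi> x y"
proof -
  note simps = bilinear_form_def bilinear_formD[OF assms] mult_simps linear_form_iff
  have "sweedler (\<lambda>a b. sweedler (\<lambda>c d. \<psi> c (S d * (b * y))) a) x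
      = sweedler (\<lambda>c t. sweedler (\<lambda>d b. \<psi> c (S d * (b * y))) t) x"
    by (rule sweedler_coassoc) (simp_all add: simps)
  also have "\<dots> = sweedler (\<lambda>c t. \<psi> c y * \<epsilon> t) x"
    using sweedler_antipode_left[of "\<lambda>z. \<psi> c (z * y)" for c] by (simp add: simps mult.assoc mult.commute)
  also have "\<dots> = \<psi> x y"
    by (rule sweedler_counit_right) (rule linear_form_bilinear[OF assms])
  finally show ?thesis .
qed

lemma sweedler_antipode_cancel_left:
  assumes "bilinear_form \<phi>"
  shows "sweedler (\<lambda>a b. sweedler (\<lambda>c d. \<phi> c (d * (S b * y))) a) x = \<phi> x y"
proof -
  note simps = bilinear_form_def bilinear_formD[OF assms] mult_simps linear_form_iff
  have "sweedler (\<lambda>a b. sweedler (\<lambda>c d. \<phi> c (d * (S b * y))) a) x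
      = sweedler (\<lambda>c t. sweedler (\<lambda>d b. \<phi> c (d * (S b * y))) t) x"
    by (rule sweedler_coassoc) (simp_all add: simps)
  also have "\<dots> = sweedler (\<lambda>c t. \<phi> c y * \<epsilon> t) x"
    using sweedler_antipode_right[of "\<lambda>z. \<phi> c (z * y)" for c] by (simp add: simps mult.assoc mult.commute)
  also have "\<dots> = \<phi> x y"
    by (rule sweedler_counit_right) (rule linear_form_bilinear[OF assms])
  finally show ?thesis .
qed

text \<open>
  The map \<open>x \<otimes> y \<mapsto> x\<^sub>1 \<otimes> S(x\<^sub>2) y\<close> is well defined from \<open>H/HK\<^sup>+ \<otimes> H\<close> to \<open>H \<otimes>\<^sub>K H\<close>, and is a left
  inverse of the canonical map. In dual form: for a balanced form \<open>\<psi>\<close>, its composite \<open>\<phi>\<close> with this map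
  vanishes on \<open>HK\<^sup>+ \<times> H\<close>, and \<open>\<phi>\<close> composed with the canonical map is \<open>\<psi>\<close>. The form \<open>\<phi>\<close> vanishes there
  because, for \<open>k \<in> K\<^sup>+\<close>, balancedness moves \<open>k\<^sub>1 \<in> K\<close> across the tensor sign:
  \<open>h\<^sub>1 k\<^sub>1 \<otimes> S(k\<^sub>2) S(h\<^sub>2) y = h\<^sub>1 \<otimes> k\<^sub>1 S(k\<^sub>2) S(h\<^sub>2) y = 0\<close>.
\<close>

lemma galois_kernel_left_ideal_plus:
  assumes K: "right_coideal_subalgebra scale \<Delta> K"
  shows "galois_kernel (left_ideal_plus K) \<subseteq> balanced_relations K"
  unfolding subset_iff mem_balanced_relations_iff
proof (intro allI impI)
  fix p \<psi> assume p: "p \<in> galois_kernel (left_ideal_plus K)" and \<psi>: "balanced_form K \<psi>"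
  have bil: "bilinear_form \<psi>" using \<psi> by (simp add: balanced_form_def)
  note simps = bilinear_form_def bilinear_formD[OF bil] mult_simps linear_form_iff
  define \<phi> where "\<phi> x y = sweedler (\<lambda>a b. \<psi> a (S b * y)) x" for x y
  have bil_\<phi>: "bilinear_form \<phi>" by (simp add: \<phi>_def simps)
  have "\<phi> x y = 0" if "x \<in> left_ideal_plus K" for x y
    using that unfolding left_ideal_plus_def
  proof (induction rule: span_induct_alt)
    case base
    show ?case by (simp add: \<phi>_def)
  next
    case (step c x z)
    then obtain h k where x: "x = h * k" "k \<in> K" "\<epsilon> k = 0" by auto
    have inner: "sweedler (\<lambda>c d. \<psi> (a * c) (S (b * d) * y)) k = 0" for a b
    proof -
      have "\<psi> (a * c) (S (b * d) * y) = \<psi> (a * c) (S d * S b * y)" for c d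
        by (rule antipode_mult) (simp add: simps)
      hence "sweedler (\<lambda>c d. \<psi> (a * c) (S (b * d) * y)) k = sweedler (\<lambda>c d. \<psi> (a * c) (S d * S b * y)) k"
        by simp
      also have "\<dots> = sweedler (\<lambda>c d. \<psi> a (c * S d * S b * y)) k"
        by (rule sweedler_right_coideal_cong[OF K \<open>k \<in> K\<close>])
          (use \<psi> in \<open>simp_all add: simps balanced_form_def mult.assoc\<close>)
      also have "\<dots> = 0"
        using sweedler_antipode_right[of "\<lambda>z. \<psi> a (z * S b * y)" k] by (simp add: simps x)
      finally show ?thesis .
    qed
    have "\<phi> x y = 0"
      unfolding \<phi>_def x by (subst sweedler_mult) (simp_all add: simps inner)
    with step show ?case by (simp add: bilinear_formD[OF bil_\<phi>])
  qed
  hence "form_vanishing_on (left_ideal_plus K) \<phi>"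
    using bil_\<phi> by (simp add: form_vanishing_on_def)
  hence "galois_eval \<phi> p = 0" using p by (simp add: galois_kernel_def)
  thus "formal_eval (*) (\<lambda>(x, y). \<psi> x y) p = 0"
    by (simp add: galois_eval_def \<phi>_def sweedler_antipode_cancel_right[OF bil])
qed

text \<open>
  For \<open>x \<in> I\<close> the tensor \<open>x\<^sub>1 \<otimes> S(x\<^sub>2)\<close> is mapped to \<open>\<pi>(x) \<otimes> 1 = 0\<close>, so by injectivity it is zero in \<open>H \<otimes>\<^sub>K H\<close>. There
  \<open>a \<otimes> b \<mapsto> f(a) \<epsilon>(b)\<close> is well defined for every linear form \<open>f\<close> that vanishes on \<open>HK\<^sup>+\<close>, and it sends
  this tensor to \<open>f(x)\<close>, since \<open>\<epsilon> \<circ> S = \<epsilon>\<close>.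
\<close>

lemma galois_kernel_subset_imp:
  assumes I: "subspace I" and K: "subalgebra scale K" and kernel: "galois_kernel I \<subseteq> balanced_relations K"
  shows "I \<subseteq> left_ideal_plus K"
proof (rule subsetI, rule ccontr)
  fix x assume x: "x \<in> I" "x \<notin> left_ideal_plus K"
  then obtain f where f: "linear_form f" "\<forall>v\<in>left_ideal_plus K. f v = 0" "f x \<noteq> 0"
    using separating_functional[OF subspace_left_ideal_plus] by blast
  define p where "p = formal_eval formal_scale (\<lambda>(a, b). Poly_Mapping.single (a, S b) 1) (comult_rep x)"
  have p_eval: "formal_eval (*) (\<lambda>(a, b). \<phi> a b) p = sweedler (\<lambda>a b. \<phi> a (S b)) x" for \<phi>
    by (simp add: p_def formal_eval_eval scalars_vector_space split_def scalar_eval_simps sweedler_def)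
  have "galois_eval \<phi> p = 0" if \<phi>: "form_vanishing_on I \<phi>" for \<phi>
    using \<phi> x(1) sweedler_antipode_cancel_left[of \<phi> 1 x]
    by (simp add: galois_eval_def p_eval form_vanishing_on_def)
  hence p: "p \<in> balanced_relations K" using kernel by (auto simp: galois_kernel_def)
  \<comment> \<open>The balancing condition \<open>f(xa) \<epsilon>(b) = f(x) \<epsilon>(ab)\<close> holds as \<open>f(xa) = \<epsilon>(a) f(x)\<close> for \<open>a \<in> K\<close>.\<close>
  have "balanced_form K (\<lambda>a b. f a * \<epsilon> b)"
    using f linear_form_left_ideal_plus[OF K _ f(1,2)]
    by (simp add: balanced_form_def bilinear_form_def linear_form_iff counit_mult algebra_simps)
  with p have "formal_eval (*) (\<lambda>(a, b). f a * \<epsilon> b) p = 0"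
    unfolding mem_balanced_relations_iff by blast
  hence "f x = 0" by (simp add: p_eval counit_antipode sweedler_counit_right[OF f(1)])
  with f(3) show False by simp
qed

text \<open>
  The canonical map is onto for every \<open>I\<close>: \<open>\<pi>(x) \<otimes> y\<close> is the image of \<open>x\<^sub>1 \<otimes> S(x\<^sub>2) y\<close>.
\<close>

lemma galois_eval_surjective:
  "\<exists>p. \<forall>\<phi>. form_vanishing_on I \<phi> \<longrightarrow> galois_eval \<phi> p = quotient_eval \<phi> q"
proof -
  define p where "p = formal_eval formal_scale (\<lambda>(X, y). formal_eval formal_scale
      (\<lambda>(a, b). Poly_Mapping.single (a, S b * y) 1) (comult_rep (SOME x. x \<in> X))) q"
  have "galois_eval \<phi> p = quotient_eval \<phi> q" if "form_vanishing_on I \<phi>" for \<phi>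
  proof -
    have "bilinear_form \<phi>" using that by (simp add: form_vanishing_on_def)
    have "galois_eval \<phi> p = formal_eval (*) (\<lambda>(X, y).
        sweedler (\<lambda>a b. sweedler (\<lambda>c d. \<phi> c (d * (S b * y))) a) (SOME x. x \<in> X)) q"
      by (simp add: galois_eval_def p_def formal_eval_eval scalars_vector_space split_def scalar_eval_simps
          sweedler_def[of "\<lambda>a b. sweedler (\<lambda>c d. \<phi> c (d * (S b * y))) a" for y])
    thus ?thesis
      by (simp add: sweedler_antipode_cancel_left[OF \<open>bilinear_form \<phi>\<close>] quotient_eval_def)
  qed
  thus ?thesis by blast
qed

lemma galois_extension_iff_kernel:
  assumes I: "subspace I" "\<And>h x. x \<in> I \<Longrightarrow> h * x \<in> I"
  shows "galois_extension scale \<Delta> (quotient_space UNIV scale I) \<longleftrightarrow>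
     galois_kernel I \<subseteq> balanced_relations (coinv I)"
proof -
  let ?Q = "quotient_space UNIV scale I" and ?K = "coinv I"
  let ?can = "canonical_map scale \<Delta> ?Q"
  have subspace: "formal.subspace (balanced_relations ?K)" by (simp add: balanced_relations_def)
  have source: "vcarrier (tensor_over scale ?K) = range (\<lambda>p. p +o balanced_relations ?K)"
    by (simp add: tensor_over_def formal_sums_mod_def balanced_relations_def)
  have target: "vcarrier (tensor ?Q (whole_space scale)) =
      (\<lambda>q. q +o quotient_relations I) ` {q. Poly_Mapping.keys q \<subseteq> range (\<lambda>x. x +o I) \<times> UNIV}"
    by (simp add: tensor_eq_quotient_space)
  have can: "?can (p +o balanced_relations ?K) = galois_formal I p +o quotient_relations I" for p
  proof -
    let ?p = "SOME q. q \<in> p +o balanced_relations ?K"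
    have "?p - p \<in> galois_kernel I"
      using formal.coset_representative[OF subspace] balanced_relations_subset_galois_kernel[OF I] by blast
    hence "galois_eval \<phi> ?p = galois_eval \<phi> p" if "form_vanishing_on I \<phi>" for \<phi>
      using that by (auto simp: galois_kernel_def galois_eval_def scalar_eval_simps)
    thus ?thesis
      by (simp add: canonical_map_eq quotient_coset_eq_iff[OF I(1)] keys_galois_formal
          quotient_eval_galois_formal[OF I(1)])
  qed
  have can_eq: "?can (p +o balanced_relations ?K) = ?can (q +o balanced_relations ?K) \<longleftrightarrow>
      p - q \<in> galois_kernel I" for p q
    by (simp add: can quotient_coset_eq_iff[OF I(1)] keys_galois_formal
          quotient_eval_galois_formal[OF I(1)] galois_kernel_def)
      (simp add: galois_eval_def scalar_eval_simps)
  have "?can ` vcarrier (tensor_over scale ?K) = vcarrier (tensor ?Q (whole_space scale))"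
  proof
    show "?can ` vcarrier (tensor_over scale ?K) \<subseteq> vcarrier (tensor ?Q (whole_space scale))"
      unfolding source target using keys_galois_formal by (auto simp: can)
    show "vcarrier (tensor ?Q (whole_space scale)) \<subseteq> ?can ` vcarrier (tensor_over scale ?K)"
    proof
      fix Y assume "Y \<in> vcarrier (tensor ?Q (whole_space scale))"
      then obtain q where q: "Y = q +o quotient_relations I"
          "Poly_Mapping.keys q \<subseteq> range (\<lambda>x. x +o I) \<times> UNIV"
        unfolding target by blast
      obtain p where "\<forall>\<phi>. form_vanishing_on I \<phi> \<longrightarrow> galois_eval \<phi> p = quotient_eval \<phi> q"
        using galois_eval_surjective by blast
      hence "?can (p +o balanced_relations ?K) = Y"
        using q(2) by (simp add: q(1) can quotient_coset_eq_iff[OF I(1)] keys_galois_formal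
          quotient_eval_galois_formal[OF I(1)])
      thus "Y \<in> ?can ` vcarrier (tensor_over scale ?K)" unfolding source by blast
    qed
  qed
  moreover have "inj_on ?can (vcarrier (tensor_over scale ?K)) \<longleftrightarrow>
      galois_kernel I \<subseteq> balanced_relations ?K"
  proof -
    have "inj_on ?can (vcarrier (tensor_over scale ?K)) \<longleftrightarrow>
        (\<forall>p q. p - q \<in> galois_kernel I \<longrightarrow> p - q \<in> balanced_relations ?K)"
      unfolding source inj_on_def by (simp add: can_eq formal.coset_eq_iff[OF subspace])
    also have "\<dots> \<longleftrightarrow> galois_kernel I \<subseteq> balanced_relations ?K"
    proof (intro iffI subsetI allI impI)
      fix p assume "\<forall>p q. p - q \<in> galois_kernel I \<longrightarrow> p - q \<in> balanced_relations ?K" "p \<in> galois_kernel I"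
      from this(1)[rule_format, of p 0] this(2) show "p \<in> balanced_relations ?K" by simp
    qed auto
    finally show ?thesis .
  qed
  ultimately show ?thesis unfolding galois_extension_def bij_betw_def by blast
qed

lemma galois_extension_iff:
  assumes "left_ideal_coideal scale \<Delta> \<epsilon> I"
  shows "galois_extension scale \<Delta> (quotient_space UNIV scale I) \<longleftrightarrow> left_ideal_plus (coinv I) = I"
proof -
  have I: "subspace I" "\<And>h x. x \<in> I \<Longrightarrow> h * x \<in> I"
    using assms by (auto simp: left_ideal_coideal_def coideal_def)
  note K = right_coideal_subalgebra_coinv[OF I]
  have "left_ideal_plus (coinv I) = I" if "galois_kernel I \<subseteq> balanced_relations (coinv I)"
    using galois_kernel_subset_imp[OF I(1) subalgebra_coinv[OF I] that]
      left_ideal_plus_coinv_subset[OF I] by (rule subset_antisym[rotated])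
  moreover have "galois_kernel I \<subseteq> balanced_relations (coinv I)" if "left_ideal_plus (coinv I) = I"
    using galois_kernel_left_ideal_plus[OF K] that by simp
  ultimately show ?thesis
    by (simp only: galois_extension_iff_kernel[OF I]) iprover
qed

end

section \<open>The correspondence\<close>

lemma quotient_space_UNIV_inject:
  "quotient_space UNIV scale I = quotient_space UNIV scale J \<longleftrightarrow> I = J"
  by (auto simp: quotient_space_def)

theorem proposition6p9:
  fixes scale :: "'k::field \<Rightarrow> 'h::ring_1 \<Rightarrow> 'h"
    and \<Delta> :: "'h \<Rightarrow> ('h \<times> 'h \<Rightarrow>\<^sub>0 'k) set"
    and \<epsilon> :: "'h \<Rightarrow> 'k"
    and S :: "'h \<Rightarrow> 'h"
  assumes "hopf_algebra scale \<Delta> \<epsilon> S"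
  shows
    "(bij_betw (quotient_by scale \<epsilon>)
        (right_coideal_subalgebras scale \<Delta>) (generalised_quotients scale \<Delta> \<epsilon>) \<and>
      bij_betw (coinvariants scale \<Delta>)
        (generalised_quotients scale \<Delta> \<epsilon>) (right_coideal_subalgebras scale \<Delta>) \<and>
      (\<forall>K \<in> right_coideal_subalgebras scale \<Delta>.
         coinvariants scale \<Delta> (quotient_by scale \<epsilon> K) = K) \<and>
      (\<forall>Q \<in> generalised_quotients scale \<Delta> \<epsilon>.
         quotient_by scale \<epsilon> (coinvariants scale \<Delta> Q) = Q))
     \<longleftrightarrow>
     (\<forall>Q \<in> generalised_quotients scale \<Delta> \<epsilon>. galois_extension scale \<Delta> Q) \<and>
     (\<forall>K \<in> right_coideal_subalgebras scale \<Delta>.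
        coinvariants scale \<Delta> (quotient_by scale \<epsilon> K) \<subseteq> K)"
proof -
  interpret hopf_algebra scale \<Delta> \<epsilon> S by fact
  let ?\<K> = "right_coideal_subalgebras scale \<Delta>" and ?\<Q> = "generalised_quotients scale \<Delta> \<epsilon>"
  have by_eq: "quotient_by scale \<epsilon> K = quotient_space UNIV scale (left_ideal_plus K)" for K
    by (simp add: quotient_by_def left_ideal_plus_def)
  have by_mem: "quotient_by scale \<epsilon> K \<in> ?\<Q>" if "K \<in> ?\<K>" for K
    using that left_ideal_coideal_left_ideal_plus
    by (auto simp: by_eq right_coideal_subalgebras_def generalised_quotients_def)
  have coinv_mem: "coinvariants scale \<Delta> Q \<in> ?\<K>" if "Q \<in> ?\<Q>" for Q
    using that by (auto simp: generalised_quotients_def right_coideal_subalgebras_def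
        left_ideal_coideal_def coideal_def intro!: right_coideal_subalgebra_coinv)
  have coinv_by: "coinvariants scale \<Delta> (quotient_by scale \<epsilon> K) = K \<longleftrightarrow>
      coinvariants scale \<Delta> (quotient_by scale \<epsilon> K) \<subseteq> K" if "K \<in> ?\<K>" for K
    using that subset_coinv_left_ideal_plus by (auto simp: by_eq right_coideal_subalgebras_def)
  have by_coinv: "quotient_by scale \<epsilon> (coinvariants scale \<Delta> Q) = Q \<longleftrightarrow> galois_extension scale \<Delta> Q"
    if "Q \<in> ?\<Q>" for Q
    using that by (auto simp: generalised_quotients_def by_eq quotient_space_UNIV_inject galois_extension_iff)
  have "bij_betw (quotient_by scale \<epsilon>) ?\<K> ?\<Q> \<and> bij_betw (coinvariants scale \<Delta>) ?\<Q> ?\<K>"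
    if "\<forall>K\<in>?\<K>. coinvariants scale \<Delta> (quotient_by scale \<epsilon> K) = K"
      "\<forall>Q\<in>?\<Q>. quotient_by scale \<epsilon> (coinvariants scale \<Delta> Q) = Q"
    using that by_mem coinv_mem
    by (intro conjI bij_betw_byWitness[of _ "coinvariants scale \<Delta>"]
        bij_betw_byWitness[of _ "quotient_by scale \<epsilon>"]) auto
  moreover have "(\<forall>K\<in>?\<K>. coinvariants scale \<Delta> (quotient_by scale \<epsilon> K) = K) \<longleftrightarrow>
      (\<forall>K\<in>?\<K>. coinvariants scale \<Delta> (quotient_by scale \<epsilon> K) \<subseteq> K)"
    by (rule ball_cong[OF refl coinv_by])
  moreover have "(\<forall>Q\<in>?\<Q>. quotient_by scale \<epsilon> (coinvariants scale \<Delta> Q) = Q) \<longleftrightarrow>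
      (\<forall>Q\<in>?\<Q>. galois_extension scale \<Delta> Q)"
    by (rule ball_cong[OF refl by_coinv])
  ultimately show ?thesis by argo
qed

end
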